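(* For every $0<t\leq 1$ there exist a continuous irreducible self-representation (group homomorphism) $$\varrho^\infty_t\colon \mathrm{Is}(\mathbf{H}^\infty)\longrightarrow \mathrm{Is}(\mathbf{H}^\infty)$$ and a $\varrho^\infty_t$-equivariant embedding $f^\infty_t\colon \mathbf{H}^\infty\to\mathbf{H}^\infty$ (that is, $f^\infty_t(gx)=\varrho^\infty_t(g)f^\infty_t(x)$ for all $g\in \mathrm{Is}(\mathbf{H}^\infty)$, $x\in\mathbf{H}^\infty$) such that for all $x,y\in\mathbf{H}^\infty$ $$\cosh d\big(f^\infty_t(x),f^\infty_t(y)\big)=\big(\cosh d(x,y)\big)^t.$$
   Context: Let $H$ be a separable infinite-dimensional real Hilbert space and let $B$ be the bilinear form on $\mathbf{R}\oplus H$ given by $B(s\oplus h,s'\oplus h')=ss'-\langle h,h'\rangle$. The infinite-dimensional real hyperbolic space is $\mathbf{H}^\infty=\{x=s\oplus h: B(x,x)=1,\ s>0\}$ with metric $d$ given by $\cosh d(x,y)=B(x,y)$. Its isometry group $\mathrm{Is}(\mathbf{H}^\infty)$ is endowed with the (Polish) topology of pointwise convergence. Every isometry of $\mathbf{H}^\infty$ is the restriction of a unique invertible linear operator of $\mathbf{R}\oplus H$ preserving $B$ and $\mathbf{H}^\infty$, so $\mathrm{Is}(\mathbf{H}^\infty)\cong \mathbf{O}_+(B)$. A representation $G\to \mathrm{Is}(\mathbf{H}^\infty)$ is irreducible if the associated linear representation on $\mathbf{R}\oplus H$ has no closed invariant linear subspaces other than $0$ and the whole space. *)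

theory Defs
  imports "HOL-Analysis.Analysis" "HOL-Algebra.Bij"
begin

section \<open>The hyperbolic space of a real Hilbert space\<close>

definition lorentz_form :: "real \<times> 'h::real_inner \<Rightarrow> real \<times> 'h \<Rightarrow> real"
  where "lorentz_form v w = fst v * fst w - snd v \<bullet> snd w"

definition hyp :: "(real \<times> 'h::real_inner) set"
  where "hyp = {x. lorentz_form x x = 1 \<and> fst x > 0}"

text \<open>The value off \<^term>\<open>hyp\<close> is irrelevant; it is fixed to \<open>0\<close> because the locale
  \<^locale>\<open>Metric_space\<close> requires symmetry and nonnegativity on the whole type.\<close>

definition hyp_dist :: "real \<times> 'h::real_inner \<Rightarrow> real \<times> 'h \<Rightarrow> real"
  where "hyp_dist x y = (if x \<in> hyp \<and> y \<in> hyp then arcosh (lorentz_form x y) else 0)"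

abbreviation hyp_topology :: "(real \<times> 'h::real_inner) topology"
  where "hyp_topology \<equiv> Metric_space.mtopology hyp hyp_dist"

section \<open>The isometry group\<close>

text \<open>Isometries are elements of \<^term>\<open>Bij hyp\<close>, i.e. they are extensional: two isometries are
  equal iff they agree on \<^term>\<open>hyp\<close>.\<close>

definition hyp_isom :: "(real \<times> 'h::real_inner \<Rightarrow> real \<times> 'h) set"
  where "hyp_isom = {g \<in> Bij hyp. \<forall>x\<in>hyp. \<forall>y\<in>hyp. hyp_dist (g x) (g y) = hyp_dist x y}"

definition hyp_isom_group :: "(real \<times> 'h::real_inner \<Rightarrow> real \<times> 'h) monoid"
  where "hyp_isom_group = (BijGroup hyp)\<lparr>carrier := hyp_isom\<rparr>"

definition hyp_isom_topology :: "(real \<times> 'h::real_inner \<Rightarrow> real \<times> 'h) topology"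
  where "hyp_isom_topology = subtopology (product_topology (\<lambda>_. hyp_topology) hyp) hyp_isom"

section \<open>The linear representation and irreducibility\<close>

definition lorentz_plus :: "(real \<times> 'h::real_inner \<Rightarrow> real \<times> 'h) set"
  where "lorentz_plus = {T. linear T \<and> bij T \<and>
    (\<forall>v w. lorentz_form (T v) (T w) = lorentz_form v w) \<and> T ` hyp = hyp}"

text \<open>Existence and uniqueness are shown in \<open>hyp_isom_extends\<close> below.\<close>

definition linear_extension ::
    "(real \<times> 'h::real_inner \<Rightarrow> real \<times> 'h) \<Rightarrow> real \<times> 'h \<Rightarrow> real \<times> 'h"
  where "linear_extension g = (THE T. T \<in> lorentz_plus \<and> (\<forall>x\<in>hyp. T x = g x))"

definition irreducible_rep ::
    "('g, 'm) monoid_scheme \<Rightarrow> ('g \<Rightarrow> real \<times> 'h::real_inner \<Rightarrow> real \<times> 'h) \<Rightarrow> bool"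
  where "irreducible_rep G \<rho> \<longleftrightarrow>
    (\<forall>V. subspace V \<and> closed V \<and> (\<forall>g\<in>carrier G. linear_extension (\<rho> g) ` V \<subseteq> V)
      \<longrightarrow> V = {0} \<or> V = UNIV)"

section \<open>Well-definedness\<close>

lemma lorentz_commute: "lorentz_form v w = lorentz_form w v"
  by (simp add: lorentz_form_def inner_commute mult.commute)

lemma lorentz_add_left: "lorentz_form (u + v) w = lorentz_form u w + lorentz_form v w"
  and lorentz_diff_left: "lorentz_form (u - v) w = lorentz_form u w - lorentz_form v w"
  and lorentz_scale_left: "lorentz_form (c *\<^sub>R v) w = c * lorentz_form v w"
  by (simp_all add: lorentz_form_def algebra_simps)

lemma lorentz_add_right: "lorentz_form w (u + v) = lorentz_form w u + lorentz_form w v"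
  and lorentz_diff_right: "lorentz_form w (u - v) = lorentz_form w u - lorentz_form w v"
  and lorentz_scale_right: "lorentz_form w (c *\<^sub>R v) = c * lorentz_form w v"
  by (simp_all add: lorentz_form_def algebra_simps)

lemmas lorentz_simps = lorentz_add_left lorentz_diff_left lorentz_scale_left
  lorentz_add_right lorentz_diff_right lorentz_scale_right

lemma lorentz_nondegenerate:
  assumes "\<And>w. lorentz_form v w = 0"
  shows "v = 0"
proof -
  have "(fst v)\<^sup>2 + (norm (snd v))\<^sup>2 = 0"
    using assms[of "(fst v, - snd v)"]
    by (simp add: lorentz_form_def power2_eq_square dot_square_norm)
  then show ?thesis
    by (simp add: sum_power2_eq_zero_iff prod_eq_iff)
qed

lemma lorentz_orthogonal:
  assumes y: "y \<in> hyp" and "lorentz_form u y = 0"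
  shows "lorentz_form u u \<le> 0" and "lorentz_form u u = 0 \<Longrightarrow> u = 0"
proof -
  obtain s h p k where [simp]: "y = (s, h)" "u = (p, k)"
    by (cases y, cases u)
  have s: "s > 0" "s\<^sup>2 = 1 + (norm h)\<^sup>2" and eq: "p * s = k \<bullet> h"
    using assms by (auto simp: hyp_def lorentz_form_def power2_eq_square dot_square_norm)
  have "(p * s)\<^sup>2 \<le> (norm k * norm h)\<^sup>2"
    unfolding eq using Cauchy_Schwarz_ineq2[of k h] by (metis abs_le_square_iff abs_mult abs_norm_cancel)
  then have *: "p\<^sup>2 * s\<^sup>2 \<le> (norm k)\<^sup>2 * s\<^sup>2 - (norm k)\<^sup>2"
    using s by (simp add: power_mult_distrib algebra_simps)
  have Q: "lorentz_form (p, k) (p, k) = p\<^sup>2 - (norm k)\<^sup>2"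
    by (simp add: lorentz_form_def power2_eq_square dot_square_norm)
  have "p\<^sup>2 * s\<^sup>2 \<le> (norm k)\<^sup>2 * s\<^sup>2"
    using * by (smt (verit) zero_le_power2)
  then show "lorentz_form u u \<le> 0"
    using s(1) by (simp add: Q)
  assume "lorentz_form u u = 0"
  then have "p\<^sup>2 = (norm k)\<^sup>2"
    by (simp add: Q)
  moreover from this have "(norm k)\<^sup>2 \<le> 0"
    using * by simp
  ultimately show "u = 0"
    by (simp add: zero_prod_def)
qed

lemma lorentz_orthogonal_Cauchy_Schwarz:
  assumes y: "y \<in> hyp" and u: "lorentz_form u y = 0" and v: "lorentz_form v y = 0"
  shows "(lorentz_form u v)\<^sup>2 \<le> lorentz_form u u * lorentz_form v v"
proof (cases "lorentz_form v v = 0")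
  case True
  then have "v = 0"
    using lorentz_orthogonal(2)[OF y v] by simp
  then show ?thesis
    by (simp add: lorentz_form_def)
next
  case False
  then have neg: "lorentz_form v v < 0"
    using lorentz_orthogonal(1)[OF y v] by simp
  define w where "w = lorentz_form v v *\<^sub>R u - lorentz_form u v *\<^sub>R v"
  have "lorentz_form w y = 0"
    by (simp add: w_def lorentz_simps u v)
  then have "lorentz_form w w \<le> 0"
    using lorentz_orthogonal(1)[OF y] by simp
  moreover have "lorentz_form w w =
      lorentz_form v v * (lorentz_form u u * lorentz_form v v - (lorentz_form u v)\<^sup>2)"
    by (simp add: w_def lorentz_simps lorentz_commute[of v u] power2_eq_square algebra_simps)
  ultimately show ?thesis
    using neg by (simp add: mult_le_0_iff)
qed

lemma lorentz_hyp_ge_1: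
  assumes "x \<in> hyp" "y \<in> hyp"
  shows "lorentz_form x y \<ge> 1"
proof -
  have x: "fst x > 0" "(fst x)\<^sup>2 = 1 + (norm (snd x))\<^sup>2"
   and y: "fst y > 0" "(fst y)\<^sup>2 = 1 + (norm (snd y))\<^sup>2"
    using assms by (auto simp: hyp_def lorentz_form_def power2_eq_square dot_square_norm)
  let ?a = "norm (snd x)" and ?b = "norm (snd y)"
  have "(1 + ?a * ?b)\<^sup>2 \<le> (fst x * fst y)\<^sup>2"
    unfolding power_mult_distrib x(2) y(2)
    using zero_le_power2[of "?a - ?b"] by (simp add: power2_eq_square algebra_simps)
  then have "1 + ?a * ?b \<le> fst x * fst y"
    by (rule power2_le_imp_le) (simp add: x(1) y(1) less_imp_le)
  then show ?thesis
    using norm_cauchy_schwarz[of "snd x" "snd y"] by (simp add: lorentz_form_def)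
qed

lemma cosh_hyp_dist: "x \<in> hyp \<Longrightarrow> y \<in> hyp \<Longrightarrow> cosh (hyp_dist x y) = lorentz_form x y"
  by (simp add: hyp_dist_def lorentz_hyp_ge_1)

lemma hyp_dist_nonneg: "hyp_dist x y \<ge> 0"
  by (simp add: hyp_dist_def lorentz_hyp_ge_1)

lemma Metric_space_hyp: "Metric_space hyp hyp_dist"
proof
  show "0 \<le> hyp_dist x y" for x y :: "real \<times> 'a"
    by (rule hyp_dist_nonneg)
  show "hyp_dist x y = hyp_dist y x" for x y :: "real \<times> 'a"
    by (simp add: hyp_dist_def lorentz_commute)
  show "hyp_dist x y = 0 \<longleftrightarrow> x = y" if x: "x \<in> hyp" and y: "y \<in> hyp" for x y :: "real \<times> 'a"
  proof -
    have xx: "lorentz_form x x = 1" and yy: "lorentz_form y y = 1"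
      using x y by (auto simp: hyp_def)
    have "x = y" if "lorentz_form x y = 1"
    proof -
      have "lorentz_form (x - y) y = 0" "lorentz_form (x - y) (x - y) = 0"
        using that xx yy by (simp_all add: lorentz_simps lorentz_commute[of y x])
      then show ?thesis
        using lorentz_orthogonal(2)[OF y, of "x - y"] by simp
    qed
    then show ?thesis
      using x y xx lorentz_hyp_ge_1[OF x y] by (auto simp: hyp_dist_def)
  qed
  show "hyp_dist x z \<le> hyp_dist x y + hyp_dist y z"
    if x: "x \<in> hyp" and y: "y \<in> hyp" and z: "z \<in> hyp" for x y z :: "real \<times> 'a"
  proof -
    let ?a = "hyp_dist x y" and ?b = "hyp_dist y z"
    have a: "lorentz_form x y = cosh ?a" and b: "lorentz_form z y = cosh ?b"
      using x y z by (simp_all add: cosh_hyp_dist lorentz_commute)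
    have one: "lorentz_form x x = 1" "lorentz_form y y = 1" "lorentz_form z z = 1"
      using x y z by (auto simp: hyp_def)
    define u where "u = x - cosh ?a *\<^sub>R y"
    define v where "v = z - cosh ?b *\<^sub>R y"
    have uy: "lorentz_form u y = 0" and vy: "lorentz_form v y = 0"
      by (simp_all add: u_def v_def lorentz_simps a b one)
    have uu: "lorentz_form u u = - (sinh ?a)\<^sup>2" and vv: "lorentz_form v v = - (sinh ?b)\<^sup>2"
      unfolding sinh_square_eq by (simp_all add: u_def v_def lorentz_simps
          lorentz_commute[of y x] lorentz_commute[of y z] a b one power2_eq_square)
    have uv: "lorentz_form u v = lorentz_form x z - cosh ?a * cosh ?b"
      by (simp add: u_def v_def lorentz_simps lorentz_commute[of y x] lorentz_commute[of y z] a b one)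
    have "(lorentz_form u v)\<^sup>2 \<le> (sinh ?a * sinh ?b)\<^sup>2"
      using lorentz_orthogonal_Cauchy_Schwarz[OF y uy vy] by (simp add: uu vv power_mult_distrib)
    then have "lorentz_form u v \<le> sinh ?a * sinh ?b"
      by (rule power2_le_imp_le) (simp add: hyp_dist_nonneg)
    then have "cosh (hyp_dist x z) \<le> cosh (?a + ?b)"
      using x z by (simp add: uv cosh_hyp_dist cosh_add)
    then show ?thesis
      by (simp add: cosh_real_nonneg_le_iff hyp_dist_nonneg)
  qed
qed

lemma group_hyp_isom: "group hyp_isom_group"
proof -
  interpret B: group "BijGroup (hyp :: (real \<times> 'a) set)"
    by (rule group_BijGroup)
  have "subgroup (hyp_isom :: (real \<times> 'a \<Rightarrow> real \<times> 'a) set) (BijGroup hyp)"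
  proof (rule B.subgroupI)
    show "hyp_isom \<subseteq> carrier (BijGroup (hyp :: (real \<times> 'a) set))"
      by (auto simp: hyp_isom_def BijGroup_def)
    have "(\<lambda>x\<in>hyp. x) \<in> (hyp_isom :: (real \<times> 'a \<Rightarrow> real \<times> 'a) set)"
      by (simp add: hyp_isom_def id_Bij)
    then show "(hyp_isom :: (real \<times> 'a \<Rightarrow> real \<times> 'a) set) \<noteq> {}"
      by blast
  next
    fix g :: "real \<times> 'a \<Rightarrow> real \<times> 'a" assume g: "g \<in> hyp_isom"
    then have gB: "g \<in> Bij hyp" by (simp add: hyp_isom_def)
    then have bij: "bij_betw g hyp hyp" by (simp add: Bij_def)
    have "hyp_dist (inv_into hyp g x) (inv_into hyp g y) = hyp_dist x y"
      if "x \<in> hyp" "y \<in> hyp" for x y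
    proof -
      let ?x = "inv_into hyp g x" and ?y = "inv_into hyp g y"
      have "hyp_dist (g ?x) (g ?y) = hyp_dist ?x ?y"
        using g that Bij_inv_into_mem[OF gB] by (simp add: hyp_isom_def)
      then show ?thesis
        using that by (simp add: bij_betw_inv_into_right[OF bij])
    qed
    then show "inv\<^bsub>BijGroup hyp\<^esub> g \<in> hyp_isom"
      by (simp add: inv_BijGroup gB hyp_isom_def restrict_inv_into_Bij)
  next
    fix f g :: "real \<times> 'a \<Rightarrow> real \<times> 'a" assume "f \<in> hyp_isom" "g \<in> hyp_isom"
    then show "f \<otimes>\<^bsub>BijGroup hyp\<^esub> g \<in> hyp_isom"
      using Bij_imp_funcset[of g hyp]
      by (auto simp: hyp_isom_def BijGroup_def compose_Bij compose_eq Pi_iff)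
  qed
  then show ?thesis
    unfolding hyp_isom_group_def by (rule subgroup.subgroup_is_group) (rule group_BijGroup)
qed

lemma span_hyp: "span (hyp :: (real \<times> 'h::real_inner) set) = UNIV"
proof -
  have "v \<in> span hyp" for v :: "real \<times> 'h"
  proof -
    obtain s h where v: "v = (s, h)" by (cases v)
    let ?r = "sqrt (1 + (norm h)\<^sup>2)"
    have pos: "0 < 1 + (norm h)\<^sup>2"
      by (simp add: add_pos_nonneg)
    then have "?r * ?r = 1 + (norm h)\<^sup>2"
      by simp
    then have 1: "(?r, h) \<in> hyp" and 2: "(1, 0) \<in> (hyp :: (real \<times> 'h) set)"
      using pos by (simp_all add: hyp_def lorentz_form_def dot_square_norm)
    have "v = (?r, h) + (s - ?r) *\<^sub>R (1, 0)"
      by (simp add: v)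
    then show ?thesis
      using 1 2 by (metis span_add span_base span_scale)
  qed
  then show ?thesis by blast
qed

lemma linear_lorentz_left: "linear (\<lambda>v. lorentz_form v w)"
  and linear_lorentz_right: "linear (\<lambda>v. lorentz_form w v)"
  by (simp_all add: linear_iff lorentz_simps)

lemma lorentz_hyp_orthogonal:
  assumes "\<And>y. y \<in> hyp \<Longrightarrow> lorentz_form v y = 0"
  shows "v = 0"
proof (rule lorentz_nondegenerate)
  fix w
  show "lorentz_form v w = 0"
    using linear_eq_on_span[OF linear_lorentz_right[of v] linear_zero, of hyp w] assms
    by (simp add: span_hyp)
qed

theorem hyp_isom_extends:
  fixes g :: "real \<times> 'h::real_inner \<Rightarrow> real \<times> 'h"
  assumes g: "g \<in> hyp_isom"
  shows "\<exists>!T. T \<in> lorentz_plus \<and> (\<forall>x\<in>hyp. T x = g x)"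
proof (rule ex_ex1I)
  have img: "g ` hyp = hyp"
    using g by (auto simp: hyp_isom_def Bij_def bij_betw_def)
  then have mem: "g x \<in> hyp" if "x \<in> hyp" for x
    using that by blast
  have pres: "lorentz_form (g x) (g y) = lorentz_form x y" if "x \<in> hyp" "y \<in> hyp" for x y
  proof -
    have "hyp_dist (g x) (g y) = hyp_dist x y"
      using g that by (simp add: hyp_isom_def)
    then show ?thesis
      using that by (simp add: mem flip: cosh_hyp_dist)
  qed
  obtain C :: "(real \<times> 'h) set" where C: "C \<subseteq> hyp" "independent C" "hyp \<subseteq> span C"
    using maximal_independent_subset[of "hyp :: (real \<times> 'h) set"] by blast
  have spanC: "span C = UNIV"
    using C(3) span_hyp span_mono[OF C(3)] by (metis span_span top.extremum_uniqueI)
  obtain T where T: "linear T" "\<And>c. c \<in> C \<Longrightarrow> T c = g c"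
    using linear_independent_extend[OF C(2)] by blast
  have *: "lorentz_form (T v) (g y) = lorentz_form v y" if "y \<in> hyp" for v y
  proof (rule linear_eq_on_span[of "\<lambda>v. lorentz_form (T v) (g y)" "\<lambda>v. lorentz_form v y" C])
    show "linear (\<lambda>v. lorentz_form (T v) (g y))"
      using linear_compose[OF T(1) linear_lorentz_left[of "g y"]] by (simp add: o_def)
    show "linear (\<lambda>v. lorentz_form v y)"
      by (rule linear_lorentz_left)
    show "lorentz_form (T c) (g y) = lorentz_form c y" if "c \<in> C" for c
      using that \<open>y \<in> hyp\<close> T(2) subsetD[OF C(1)] pres by simp
    show "v \<in> span C"
      by (simp add: spanC)
  qed
  have Tg: "T x = g x" if x: "x \<in> hyp" for x
  proof -
    have "lorentz_form (T x - g x) y = 0" if "y \<in> hyp" for y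
    proof -
      have "y \<in> g ` hyp"
        using that by (simp add: img)
      then obtain z where "y = g z" "z \<in> hyp"
        by (rule imageE)
      then show ?thesis
        using *[of z x] pres[OF x] by (simp add: lorentz_diff_left)
    qed
    then show ?thesis
      using lorentz_hyp_orthogonal[of "T x - g x"] by simp
  qed
  have TT: "lorentz_form (T v) (T w) = lorentz_form v w" for v w
  proof (rule linear_eq_on_span[of "\<lambda>w. lorentz_form (T v) (T w)" "\<lambda>w. lorentz_form v w" hyp])
    show "linear (\<lambda>w. lorentz_form (T v) (T w))"
      using linear_compose[OF T(1) linear_lorentz_right[of "T v"]] by (simp add: o_def)
    show "linear (\<lambda>w. lorentz_form v w)"
      by (rule linear_lorentz_right)
    show "lorentz_form (T v) (T y) = lorentz_form v y" if "y \<in> hyp" for y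
      using that * Tg by simp
    show "w \<in> span hyp"
      by (simp add: span_hyp)
  qed
  have "inj T"
  proof (subst linear_injective_0[OF T(1)], intro allI impI)
    fix v assume "T v = 0"
    then have "lorentz_form v w = 0" for w
      using TT[of v w] by (simp add: lorentz_form_def)
    then show "v = 0"
      by (rule lorentz_nondegenerate)
  qed
  moreover have Timg: "T ` hyp = hyp"
    using Tg img image_cong[of hyp hyp T g] by simp
  then have "surj T"
    using linear_span_image[OF T(1), of hyp] by (simp add: span_hyp)
  ultimately show "\<exists>T. T \<in> lorentz_plus \<and> (\<forall>x\<in>hyp. T x = g x)"
    using T(1) TT Timg Tg unfolding lorentz_plus_def bij_def by blast
next
  fix S T
  assume S: "S \<in> lorentz_plus \<and> (\<forall>x\<in>hyp. S x = g x)"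
    and T: "T \<in> lorentz_plus \<and> (\<forall>x\<in>hyp. T x = g x)"
  show "S = T"
  proof
    fix v
    show "S v = T v"
    proof (rule linear_eq_on_span[of S T hyp])
      show "linear S" "linear T"
        using S T by (simp_all add: lorentz_plus_def)
      show "S x = T x" if "x \<in> hyp" for x
        using S T that by simp
      show "v \<in> span hyp"
        by (simp add: span_hyp)
    qed
  qed
qed

end

theory Submission
  imports Defs
begin

text \<open>
  The kernel \<open>lorentz_form x y powr t = (cosh d(x, y)) powr t\<close> is of hyperbolic type: for
  \<open>0 < t \<le> 1\<close>, the kernel
  \<open>fst x powr t * fst y powr t - lorentz_form x y powr t\<close> is positive definite, because in the
  projective ball model it becomes a rescaling of \<open>1 - (1 - z) powr t\<close> with \<open>z\<close> an inner product,
  and the power series of this function has nonnegative coefficients. Realizing it by a map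
  \<open>\<psi>\<close> into the Hilbert space, chosen with total image, and putting
  \<open>f x = (fst x powr t, \<psi> x)\<close> gives \<open>lorentz_form (f x) (f y) = lorentz_form x y powr t\<close>
  (\<open>lorentz_power_map_exists\<close>).

  For an isometry \<open>g\<close>, the families \<open>f\<close> and \<open>f \<circ> g\<close> have the same Lorentz products and
  total image, so there is a unique Lorentz transformation \<open>lift g\<close> with
  \<open>lift g (f x) = f (g x)\<close> (\<open>lift_exists\<close>, \<open>lorentz_plus_eqI\<close>). Uniqueness makes the assignment a
  homomorphism. It is continuous because on the dense span of the image of \<open>f\<close> it depends
  continuously on \<open>g\<close>, with locally uniform bounds (\<open>tendsto_lorentz_lift\<close>).

  Irreducibility comes from the stabilizer of the point \<open>(1, 0)\<close>, which \<open>f\<close> fixes: in infinite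
  dimension the image of a sphere about \<open>(1, 0)\<close> contains infinitely many points whose components
  orthogonal to \<open>(1, 0)\<close> are pairwise orthogonal of equal length, so the stabilizer fixes only the
  multiples of \<open>(1, 0)\<close> (\<open>stabilizer_fixed_vector\<close>). Applied to the projection of \<open>(1, 0)\<close> to
  an invariant closed subspace, this together with transitivity shows that the subspace is
  trivial (\<open>irreducible_rep_rep\<close>).
\<close>

section \<open>Hilbert spaces\<close>

lemma closed_orthogonal_inner: "closed {u::'a::real_inner. u \<bullet> w = 0}"
  by (intro closed_Collect_eq continuous_intros)

lemma subspace_closure:
  fixes S :: "'a::real_normed_vector set"
  assumes "subspace S"
  shows "subspace (closure S)"
  unfolding subspace_def
proof (intro conjI ballI allI)
  show "0 \<in> closure S"
    using subspace_0[OF assms] closure_subset by blast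
next
  fix x y assume "x \<in> closure S" "y \<in> closure S"
  then obtain f g where "\<forall>n. f n \<in> S" "f \<longlonglongrightarrow> x" "\<forall>n. g n \<in> S" "g \<longlonglongrightarrow> y"
    unfolding closure_sequential by blast
  then show "x + y \<in> closure S"
    unfolding closure_sequential
    by (intro exI[of _ "\<lambda>n. f n + g n"]) (auto intro: tendsto_add subspace_add[OF assms])
next
  fix c x assume "x \<in> closure S"
  then obtain f where "\<forall>n. f n \<in> S" "f \<longlonglongrightarrow> x"
    unfolding closure_sequential by blast
  then show "c *\<^sub>R x \<in> closure S"
    unfolding closure_sequential
    by (intro exI[of _ "\<lambda>n. c *\<^sub>R f n"]) (auto intro: tendsto_intros subspace_scale[OF assms])
qed

lemma closure_span_orthogonal:
  fixes A B :: "'a::real_inner set"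
  assumes AB: "\<And>a b. a \<in> A \<Longrightarrow> b \<in> B \<Longrightarrow> a \<bullet> b = 0"
    and u: "u \<in> closure (span A)" and v: "v \<in> closure (span B)"
  shows "u \<bullet> v = 0"
proof -
  have *: "closure (span C) \<subseteq> {u. u \<bullet> w = 0}" if "\<And>c. c \<in> C \<Longrightarrow> c \<bullet> w = 0" for C and w :: 'a
  proof (rule closure_minimal[OF _ closed_orthogonal_inner], rule span_minimal)
    show "subspace {u. u \<bullet> w = 0}"
      by (simp add: subspace_def inner_left_distrib)
  qed (use that in auto)
  have "u \<bullet> b = 0" if "b \<in> B" for b
    using *[of A b] AB that u by auto
  then show ?thesis
    using *[of B u] v by (auto simp: inner_commute)
qed

text \<open>The projection is the limit of a minimizing sequence for the distance to \<open>V\<close>, which is Cauchy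
  by the parallelogram law.\<close>

theorem orthogonal_projection_exists:
  fixes V :: "'a::{real_inner, complete_space} set"
  assumes V: "subspace V" "closed V"
  obtains p where "p \<in> V" "\<And>v. v \<in> V \<Longrightarrow> (x - p) \<bullet> v = 0"
proof -
  define d where "d = (INF v\<in>V. (norm (x - v))\<^sup>2)"
  have ne: "V \<noteq> {}"
    using subspace_0[OF V(1)] by blast
  have bdd: "bdd_below ((\<lambda>v. (norm (x - v))\<^sup>2) ` V)"
    by (rule bdd_belowI[of _ 0]) auto
  have d_le: "d \<le> (norm (x - v))\<^sup>2" if "v \<in> V" for v
    unfolding d_def by (rule cINF_lower[OF bdd that])
  have "\<exists>v\<in>V. (norm (x - v))\<^sup>2 < d + inverse (real (Suc n))" for n
    using cINF_less_iff[OF ne bdd, of "d + inverse (real (Suc n))"] by (simp flip: d_def)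
  then obtain v where v: "\<And>n. v n \<in> V" "\<And>n. (norm (x - v n))\<^sup>2 < d + inverse (real (Suc n))"
    by metis
  have par: "(norm (v m - v n))\<^sup>2 \<le> 2 * (inverse (real (Suc m)) + inverse (real (Suc n)))" for m n
  proof -
    have "(1/2) *\<^sub>R (v m + v n) \<in> V"
      using v(1) V(1) by (simp add: subspace_add subspace_scale)
    from d_le[OF this] have "4 * d \<le> (norm ((x - v m) + (x - v n)))\<^sup>2"
      by (simp add: power2_norm_eq_inner algebra_simps)
    moreover have "(norm (v m - v n))\<^sup>2 + (norm ((x - v m) + (x - v n)))\<^sup>2
        = 2 * (norm (x - v m))\<^sup>2 + 2 * (norm (x - v n))\<^sup>2"
      by (simp add: power2_norm_eq_inner algebra_simps inner_commute)
    ultimately show ?thesis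
      using v(2)[of m] v(2)[of n] by argo
  qed
  have "Cauchy v"
  proof (rule metric_CauchyI)
    fix e :: real assume "e > 0"
    then obtain N where N: "inverse (real (Suc N)) < e\<^sup>2 / 4"
      using reals_Archimedean[of "e\<^sup>2/4"] by auto
    have "dist (v m) (v n) < e" if "m \<ge> N" "n \<ge> N" for m n
    proof -
      have "inverse (real (Suc m)) \<le> inverse (real (Suc N))" "inverse (real (Suc n)) \<le> inverse (real (Suc N))"
        using that by auto
      then have "(norm (v m - v n))\<^sup>2 < e\<^sup>2"
        using par[of m n] N by argo
      then show ?thesis
        using \<open>e > 0\<close> by (simp add: dist_norm power2_less_imp_less)
    qed
    then show "\<exists>N. \<forall>m\<ge>N. \<forall>n\<ge>N. dist (v m) (v n) < e"
      by blast
  qed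
  then obtain p where p: "v \<longlonglongrightarrow> p"
    using Cauchy_convergent_iff convergent_def by blast
  have "p \<in> V"
    using V(2) v(1) p closed_sequentially by blast
  have "(norm (x - p))\<^sup>2 \<le> d"
  proof (rule LIMSEQ_le)
    show "(\<lambda>n. (norm (x - v n))\<^sup>2) \<longlonglongrightarrow> (norm (x - p))\<^sup>2"
      by (intro tendsto_intros p)
    show "(\<lambda>n. d + inverse (real (Suc n))) \<longlonglongrightarrow> d"
      using tendsto_add[OF tendsto_const LIMSEQ_inverse_real_of_nat, of d] by simp
    show "\<exists>N. \<forall>n\<ge>N. (norm (x - v n))\<^sup>2 \<le> d + inverse (real (Suc n))"
      using v(2) less_imp_le by blast
  qed
  have "(x - p) \<bullet> w = 0" if w: "w \<in> V" for w
  proof (cases "w = 0")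
    case False
    define c where "c = ((x - p) \<bullet> w) / (w \<bullet> w)"
    have "p + c *\<^sub>R w \<in> V"
      using \<open>p \<in> V\<close> w V(1) by (simp add: subspace_add subspace_scale)
    then have "(norm (x - p))\<^sup>2 \<le> (norm (x - (p + c *\<^sub>R w)))\<^sup>2"
      using d_le \<open>(norm (x - p))\<^sup>2 \<le> d\<close> order_trans by blast
    also have "\<dots> = (norm (x - p))\<^sup>2 - 2 * c * ((x - p) \<bullet> w) + c * c * (w \<bullet> w)"
      by (simp add: power2_norm_eq_inner algebra_simps inner_commute)
    also have "\<dots> = (norm (x - p))\<^sup>2 - ((x - p) \<bullet> w)\<^sup>2 / (w \<bullet> w)"
      using False by (simp add: c_def power2_eq_square field_simps)
    finally have "((x - p) \<bullet> w)\<^sup>2 / (w \<bullet> w) \<le> 0"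
      by simp
    moreover have "w \<bullet> w > 0"
      using False by simp
    ultimately show ?thesis
      by (simp add: divide_le_0_iff)
  qed simp
  with \<open>p \<in> V\<close> show ?thesis
    by (rule that)
qed

text \<open>This is how totality of a family is turned into density of its span.\<close>

lemma closed_subspace_eq_UNIV:
  fixes V :: "'a::{real_inner, complete_space} set"
  assumes "subspace V" "closed V" and tot: "\<And>u. (\<And>v. v \<in> V \<Longrightarrow> u \<bullet> v = 0) \<Longrightarrow> u = 0"
  shows "V = UNIV"
proof -
  have "x \<in> V" for x
  proof -
    obtain p where "p \<in> V" "\<And>v. v \<in> V \<Longrightarrow> (x - p) \<bullet> v = 0"
      using orthogonal_projection_exists[OF assms(1,2)] by blast
    then show ?thesis
      using tot[of "x - p"] by simp
  qed
  then show ?thesis by blast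
qed

text \<open>A family with the same Gram matrix as a total family is its image under a linear isometry. The
  isometry is obtained through its graph, the closed span of the pairs \<open>(\<phi> x, \<psi> x)\<close>: there both
  components have the same norm, so the first projection is injective with closed image, and
  by totality it is onto.\<close>

theorem isometry_of_Gram:
  fixes \<phi> :: "'i \<Rightarrow> 'a::{real_inner, complete_space}" and \<psi> :: "'i \<Rightarrow> 'b::{real_inner, complete_space}"
  assumes Gram: "\<And>x y. x \<in> X \<Longrightarrow> y \<in> X \<Longrightarrow> \<phi> x \<bullet> \<phi> y = \<psi> x \<bullet> \<psi> y"
    and tot: "\<And>u. (\<And>x. x \<in> X \<Longrightarrow> u \<bullet> \<phi> x = 0) \<Longrightarrow> u = 0"
  obtains U where "linear U" "\<And>v w. U v \<bullet> U w = v \<bullet> w" "\<And>x. x \<in> X \<Longrightarrow> U (\<phi> x) = \<psi> x"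
    "closed (range U)" "range U \<subseteq> closure (span (\<psi> ` X))"
proof -
  define G where "G = closure (span ((\<lambda>x. (\<phi> x, \<psi> x)) ` X))"
  have G: "subspace G" "closed G"
    by (simp_all add: G_def subspace_closure)
  have mem: "(\<phi> x, \<psi> x) \<in> G" if "x \<in> X" for x
    unfolding G_def using that by (intro subsetD[OF closure_subset] span_base) blast
  (* Q measures the failure of fst and snd to have the same inner products; it vanishes on G *)
  define Q :: "'a \<times> 'b \<Rightarrow> 'a \<times> 'b \<Rightarrow> real" where "Q a b = fst a \<bullet> fst b - snd a \<bullet> snd b" for a b
  have Q: "closed {a. Q a b = 0}" "subspace {a. Q a b = 0}" for b
    unfolding Q_def
    by (intro closed_Collect_eq continuous_intros) (simp add: subspace_def algebra_simps)
  have Q_sub: "G \<subseteq> {a. Q a b = 0}" if "\<And>x. x \<in> X \<Longrightarrow> Q (\<phi> x, \<psi> x) b = 0" for b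
    unfolding G_def by (intro closure_minimal span_minimal Q) (use that in auto)
  have Q_comm: "Q a b = Q b a" for a b
    by (simp add: Q_def inner_commute)
  have "Q a (\<phi> x, \<psi> x) = 0" if "a \<in> G" "x \<in> X" for a x
    using Q_sub[of "(\<phi> x, \<psi> x)"] that Gram by (auto simp: Q_def)
  then have Q0: "Q a b = 0" if "a \<in> G" "b \<in> G" for a b
    using Q_sub[of b] that Q_comm by auto
  have norm_eq: "norm (fst a) = norm (snd a)" if "a \<in> G" for a
    using Q0[OF that that] by (simp add: Q_def norm_eq_sqrt_inner)
  have norm_ge: "norm (fst a) \<ge> (1/2) * norm a" if "a \<in> G" for a
    using norm_eq[OF that] norm_Pair_le[of "fst a" "snd a"] by simp
  have "complete (fst ` G)"
    by (rule complete_isometric_image[of "1/2", OF _ G(1)])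
       (use norm_ge G in \<open>auto simp: bounded_linear_fst complete_eq_closed\<close>)
  then have "closed (fst ` G)"
    by (simp add: complete_eq_closed)
  have "fst ` G = UNIV"
  proof (rule closed_subspace_eq_UNIV[OF _ \<open>closed (fst ` G)\<close>])
    show "subspace (fst ` G)"
      by (intro linear_subspace_image G) (simp add: linear_iff)
    show "u = 0" if "\<And>v. v \<in> fst ` G \<Longrightarrow> u \<bullet> v = 0" for u
      by (rule tot, rule that) (use mem in force)
  qed
  then have "\<forall>v. \<exists>u. (v, u) \<in> G"
    by (metis (no_types, lifting) imageE prod.collapse UNIV_I)
  then obtain U where U: "\<And>v. (v, U v) \<in> G"
    by metis
  have uniq: "u = U v" if "(v, u) \<in> G" for u v
    using norm_eq[OF subspace_diff[OF G(1) that U[of v]]] by simp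
  have lin: "linear U"
  proof (rule linearI)
    fix v w c
    show "U (v + w) = U v + U w"
      using uniq[of "v + w" "U v + U w"] subspace_add[OF G(1) U[of v] U[of w]] by simp
    show "U (c *\<^sub>R v) = c *\<^sub>R U v"
      using uniq[of "c *\<^sub>R v" "c *\<^sub>R U v"] subspace_scale[OF G(1) U[of v], of c] by simp
  qed
  have isom: "U v \<bullet> U w = v \<bullet> w" for v w
    using Q0[OF U[of v] U[of w]] by (simp add: Q_def)
  have normU: "norm (U v) = norm v" for v
    by (simp add: norm_eq_sqrt_inner isom)
  have "complete (range U)"
    by (rule complete_isometric_image[of 1])
       (use lin normU in \<open>auto simp: complete_UNIV bounded_linear_def bounded_linear_axioms_def intro!: exI[of _ 1]\<close>)
  then have "closed (range U)"
    by (simp add: complete_eq_closed)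
  moreover have "range U \<subseteq> closure (span (\<psi> ` X))"
  proof -
    have lin2: "linear (snd :: 'a \<times> 'b \<Rightarrow> 'b)"
      by (simp add: linear_iff)
    have "snd ` G \<subseteq> closure (snd ` span ((\<lambda>x. (\<phi> x, \<psi> x)) ` X))"
      unfolding G_def by (intro image_closure_subset continuous_intros closed_closure closure_subset)
    also have "snd ` span ((\<lambda>x. (\<phi> x, \<psi> x)) ` X) = span (\<psi> ` X)"
      by (simp add: linear_span_image[OF lin2, symmetric] image_image)
    finally show ?thesis
      using U by force
  qed
  moreover have "U (\<phi> x) = \<psi> x" if "x \<in> X" for x
    using uniq[OF mem[OF that]] by simp
  ultimately show ?thesis
    using that lin isom by blast
qed

text \<open>The range of the sequence is a maximal orthonormal subset of \<open>K\<close>. It is countable because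
  distinct elements are at distance \<open>\<surd>2\<close>.\<close>

lemma orthonormal_sequence_exists:
  fixes K :: "'a::{real_inner, complete_space} set"
  assumes sep: "separable_space (euclidean :: 'a topology)"
    and inf: "\<nexists>S. finite S \<and> K \<subseteq> span S" and K: "subspace K"
  obtains e :: "nat \<Rightarrow> 'a" where "\<And>i j. e i \<bullet> e j = (if i = j then 1 else 0)"
    "range e \<subseteq> K" "\<And>u. u \<in> K \<Longrightarrow> (\<And>i. u \<bullet> e i = 0) \<Longrightarrow> u = 0"
proof -
  define ON where "ON E \<longleftrightarrow> E \<subseteq> K \<and> (\<forall>x\<in>E. \<forall>y\<in>E. x \<bullet> y = (if x = y then 1 else 0))" for E
  have "\<exists>M\<in>Collect ON. \<forall>E\<in>Collect ON. M \<subseteq> E \<longrightarrow> E = M"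
  proof (rule subset_Zorn_nonempty)
    show "Collect ON \<noteq> {}"
      by (rule ex_in_conv[THEN iffD1], rule exI[of _ "{}"]) (simp add: ON_def)
    fix \<C> assume C: "\<C> \<noteq> {}" "subset.chain (Collect ON) \<C>"
    have "x \<bullet> y = (if x = y then 1 else 0)" if xy: "x \<in> E" "y \<in> F" "E \<in> \<C>" "F \<in> \<C>" for x y E F
    proof -
      have "E \<subseteq> F \<or> F \<subseteq> E" "ON E" "ON F"
        using C(2) xy unfolding subset_chain_def by auto
      then show ?thesis
        using xy unfolding ON_def by blast
    qed
    moreover have "\<Union>\<C> \<subseteq> K"
      using C(2) unfolding subset_chain_def ON_def by blast
    ultimately show "\<Union>\<C> \<in> Collect ON"
      unfolding ON_def by blast
  qed
  then obtain E where E: "ON E" and max: "\<And>F. ON F \<Longrightarrow> E \<subseteq> F \<Longrightarrow> F = E"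
    by auto
  have Eip: "x \<bullet> y = (if x = y then 1 else 0)" if "x \<in> E" "y \<in> E" for x y
    using E that unfolding ON_def by blast
  have EK: "E \<subseteq> K" using E unfolding ON_def by auto
  have total: "u = 0" if u: "u \<in> K" "\<And>x. x \<in> E \<Longrightarrow> u \<bullet> x = 0" for u
  proof (rule ccontr)
    assume "u \<noteq> 0"
    define w where "w = u /\<^sub>R norm u"
    have "w \<in> K"
      using u(1) K by (simp add: w_def subspace_scale)
    moreover have w1: "w \<bullet> w = 1"
      using \<open>u \<noteq> 0\<close> by (simp add: w_def dot_square_norm power2_eq_square)
    moreover have w0: "w \<bullet> x = 0" "x \<bullet> w = 0" if "x \<in> E" for x
      using u(2)[OF that] by (simp_all add: w_def inner_commute)
    ultimately have "ON (insert w E)"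
      using E unfolding ON_def by force
    then have "w \<in> E"
      using max[of "insert w E"] by blast
    then show False
      using w1 w0 by force
  qed
  have "infinite E"
  proof
    assume fin: "finite E"
    have "u \<in> span E" if "u \<in> K" for u
    proof -
      define p where "p = (\<Sum>x\<in>E. (u \<bullet> x) *\<^sub>R x)"
      have p: "p \<in> span E"
        unfolding p_def by (intro span_sum span_scale span_base)
      have "p \<bullet> y = u \<bullet> y" if "y \<in> E" for y
      proof -
        have "p \<bullet> y = (\<Sum>x\<in>E. if x = y then u \<bullet> y else 0)"
          unfolding p_def inner_sum_left by (rule sum.cong) (use Eip that in auto)
        then show ?thesis
          using fin that by simp
      qed
      moreover have "span E \<subseteq> K"
        by (rule span_minimal[OF EK K])
      ultimately have "u - p = 0"
        using total[of "u - p"] p that K subspace_diff by (force simp: inner_diff_left)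
      then show ?thesis
        using p by simp
    qed
    then show False
      using inf fin by blast
  qed
  have "countable E"
  proof -
    obtain D :: "'a set" where D: "countable D" "closure D = UNIV"
      using sep unfolding separable_space_def by auto
    have "\<exists>d\<in>D. dist d x < 1/2" for x
      using D(2) closure_approachable[of x D] by (metis UNIV_I half_gt_zero zero_less_one)
    then obtain \<delta> where \<delta>: "\<And>x. \<delta> x \<in> D" "\<And>x. dist (\<delta> x) x < 1/2"
      by metis
    have "inj_on \<delta> E"
    proof (rule inj_onI, rule ccontr)
      fix x y assume xy: "x \<in> E" "y \<in> E" "\<delta> x = \<delta> y" "x \<noteq> y"
      have "dist x y < 1"
        using \<delta>(2)[of x] \<delta>(2)[of y] xy(3) dist_triangle_half_r by metis
      then have "(norm (x - y))\<^sup>2 < 1"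
        by (simp add: dist_norm abs_square_less_1)
      moreover have "(norm (x - y))\<^sup>2 = 2"
        using xy Eip by (simp add: power2_norm_eq_inner algebra_simps)
      ultimately show False by simp
    qed
    moreover have "\<delta> ` E \<subseteq> D"
      using \<delta> by blast
    ultimately show ?thesis
      using D(1) countable_image_inj_on countable_subset by blast
  qed
  then have bij: "bij_betw (from_nat_into E) UNIV E"
    using \<open>infinite E\<close> by (simp add: bij_betw_from_nat_into)
  show ?thesis
  proof (rule that[of "from_nat_into E"])
    show "from_nat_into E i \<bullet> from_nat_into E j = (if i = j then 1 else 0)" for i j
      using Eip[of "from_nat_into E i" "from_nat_into E j"] bij unfolding bij_betw_def
      by (metis inj_eq rangeI)
    show "range (from_nat_into E) \<subseteq> K"
      using bij EK by (simp add: bij_betw_def)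
    show "u = 0" if "u \<in> K" "\<And>i. u \<bullet> from_nat_into E i = 0" for u
      using total[OF that(1)] that(2) bij unfolding bij_betw_def by (metis imageE)
  qed
qed

lemma orthogonal_series:
  fixes a :: "nat \<Rightarrow> 'a::{real_inner, complete_space}"
  assumes "\<And>i j. i \<noteq> j \<Longrightarrow> a i \<bullet> a j = 0" and "summable (\<lambda>i. (norm (a i))\<^sup>2)"
  shows "summable a"
proof (subst summable_iff_convergent, rule Cauchy_convergent, rule CauchyI')
  fix \<epsilon> :: real assume "\<epsilon> > 0"
  then obtain N where N: "\<And>m n. m \<ge> N \<Longrightarrow> norm (\<Sum>i\<in>{m..<n}. (norm (a i))\<^sup>2) < \<epsilon>\<^sup>2"
    using assms(2) unfolding summable_Cauchy by (meson zero_less_power)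
  have "dist (sum a {..<m}) (sum a {..<n}) < \<epsilon>" if "m \<ge> N" "m < n" for m n
  proof -
    have "sum a {..<n} - sum a {..<m} = sum a {m..<n}"
      using that by (simp add: sum_diff_nat_ivl lessThan_atLeast0)
    moreover have "(norm (sum a {m..<n}))\<^sup>2 = (\<Sum>i\<in>{m..<n}. (norm (a i))\<^sup>2)"
      by (rule norm_sum_Pythagorean) (auto simp: pairwise_def orthogonal_def assms(1))
    moreover have "\<dots> < \<epsilon>\<^sup>2"
      using N[OF that(1), of n] by simp
    ultimately have "norm (sum a {..<n} - sum a {..<m}) < \<epsilon>"
      using \<open>\<epsilon> > 0\<close> by (simp add: power2_less_imp_less)
    then show ?thesis
      by (simp add: dist_norm norm_minus_commute)
  qed
  then show "\<exists>M. \<forall>m\<ge>M. \<forall>n>m. dist (sum a {..<m}) (sum a {..<n}) < \<epsilon>"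
    by blast
qed

lemma orthogonal_series_inner:
  fixes a b :: "nat \<Rightarrow> 'a::real_inner"
  assumes "summable a" "summable b" and ab: "\<And>i j. i \<noteq> j \<Longrightarrow> a i \<bullet> b j = 0"
  shows "(\<lambda>i. a i \<bullet> b i) sums (suminf a \<bullet> suminf b)"
proof -
  have "sum a {..<n} \<bullet> sum b {..<n} = (\<Sum>i<n. a i \<bullet> b i)" for n
  proof -
    have "sum a {..<n} \<bullet> sum b {..<n} = (\<Sum>i<n. \<Sum>j<n. a i \<bullet> b j)"
      by (simp only: inner_sum_left) (simp only: inner_sum_right)
    also have "\<dots> = (\<Sum>i<n. \<Sum>j<n. if i = j then a i \<bullet> b i else 0)"
      by (intro sum.cong refl) (use ab in auto)
    finally show ?thesis
      by simp
  qed
  moreover have "(\<lambda>n. sum a {..<n} \<bullet> sum b {..<n}) \<longlonglongrightarrow> suminf a \<bullet> suminf b"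
    by (intro tendsto_inner summable_LIMSEQ assms)
  ultimately show ?thesis
    by (simp add: sums_def)
qed

section \<open>Kernels realized in a Hilbert space\<close>

text \<open>A total orthonormal sequence, that is, a countably infinite Hilbert basis.\<close>

locale orthonormal_basis =
  fixes e :: "nat \<Rightarrow> 'a::{real_inner, complete_space}"
  assumes inner_basis: "e i \<bullet> e j = (if i = j then 1 else 0)"
    and total_basis: "(\<And>i. u \<bullet> e i = 0) \<Longrightarrow> u = 0"
begin

lemma Bessel_sum: "(\<Sum>i<n. (u \<bullet> e i)\<^sup>2) \<le> (norm u)\<^sup>2"
proof -
  define p where "p = (\<Sum>i<n. (u \<bullet> e i) *\<^sub>R e i)"
  have up: "u \<bullet> p = (\<Sum>i<n. (u \<bullet> e i)\<^sup>2)"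
    by (simp add: p_def inner_sum_right power2_eq_square)
  have "p \<bullet> e j = u \<bullet> e j" if "j < n" for j
  proof -
    have "p \<bullet> e j = (\<Sum>i<n. if i = j then u \<bullet> e j else 0)"
      unfolding p_def inner_sum_left by (rule sum.cong) (auto simp: inner_basis)
    then show ?thesis
      using that by simp
  qed
  then have pp: "p \<bullet> p = (\<Sum>i<n. (u \<bullet> e i)\<^sup>2)"
    by (subst (2) p_def) (simp add: inner_sum_right power2_eq_square)
  have "0 \<le> (u - p) \<bullet> (u - p)"
    by simp
  also have "\<dots> = (norm u)\<^sup>2 - (\<Sum>i<n. (u \<bullet> e i)\<^sup>2)"
    using up pp by (simp add: power2_norm_eq_inner algebra_simps inner_commute)
  finally show ?thesis
    by simp
qed

lemma Parseval: "(\<lambda>i. (u \<bullet> e i) * (v \<bullet> e i)) sums (u \<bullet> v)"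
proof -
  have sm: "summable (\<lambda>i. (w \<bullet> e i) *\<^sub>R e i)" for w
  proof (rule orthogonal_series)
    have "summable (\<lambda>i. (w \<bullet> e i)\<^sup>2)"
      by (rule summableI_nonneg_bounded[OF _ Bessel_sum]) auto
    then show "summable (\<lambda>i. (norm ((w \<bullet> e i) *\<^sub>R e i))\<^sup>2)"
      by (simp add: power_mult_distrib power2_norm_eq_inner inner_basis)
  qed (simp add: inner_basis)
  have expand: "suminf (\<lambda>i. (w \<bullet> e i) *\<^sub>R e i) = w" for w
  proof -
    have "suminf (\<lambda>i. (w \<bullet> e i) *\<^sub>R e i) \<bullet> e j = w \<bullet> e j" for j
    proof -
      have "(\<lambda>i. ((w \<bullet> e i) *\<^sub>R e i) \<bullet> e j) sums (suminf (\<lambda>i. (w \<bullet> e i) *\<^sub>R e i) \<bullet> e j)"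
        by (rule bounded_linear.sums[OF bounded_linear_inner_left summable_sums[OF sm]])
      moreover have "(\<lambda>i. ((w \<bullet> e i) *\<^sub>R e i) \<bullet> e j) = (\<lambda>i. if i = j then w \<bullet> e j else 0)"
        by (auto simp: inner_basis)
      ultimately show ?thesis
        using sums_If_finite_set'[OF sums_zero, of "{j}"] sums_single[of j "\<lambda>_. w \<bullet> e j"] sums_unique2 by metis
    qed
    then have "suminf (\<lambda>i. (w \<bullet> e i) *\<^sub>R e i) - w = 0"
      by (intro total_basis) (simp add: inner_diff_left)
    then show ?thesis
      by simp
  qed
  show ?thesis
    using orthogonal_series_inner[OF sm[of u] sm[of v]] by (simp add: expand inner_basis mult.commute)
qed

text \<open>Isometric copies of the space inside itself with pairwise orthogonal ranges, obtained by
  splitting the basis along a bijection between pairs of naturals and naturals. They take the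
  place of a countable Hilbert sum.\<close>

lemma orthogonal_copies:
  obtains V :: "nat \<Rightarrow> 'a \<Rightarrow> 'a"
  where "\<And>m n u v. V m u \<bullet> V n v = (if m = n then u \<bullet> v else 0)"
proof -
  let ?E = "\<lambda>n j. e (prod_encode (n, j))"
  have "\<exists>V :: 'a \<Rightarrow> 'a. (\<forall>u v. V u \<bullet> V v = u \<bullet> v) \<and> (\<forall>u. V u \<in> closure (span (range (?E n))))" for n
  proof -
    have tot: "u = 0" if "\<And>i. i \<in> UNIV \<Longrightarrow> u \<bullet> e i = 0" for u
      by (rule total_basis) (use that in simp)
    show ?thesis
    proof (rule isometry_of_Gram[where X=UNIV and \<phi>=e and \<psi>="?E n", OF _ tot])
      fix U :: "'a \<Rightarrow> 'a"
      assume "\<And>v w. U v \<bullet> U w = v \<bullet> w" and "range U \<subseteq> closure (span (range (?E n)))"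
      then show ?thesis
        by (intro exI[of _ U]) blast
    qed (simp_all add: inner_basis)
  qed
  then obtain V :: "nat \<Rightarrow> 'a \<Rightarrow> 'a" where V: "\<And>n u v. V n u \<bullet> V n v = u \<bullet> v"
      "\<And>n u. V n u \<in> closure (span (range (?E n)))"
    by metis
  have "V m u \<bullet> V n v = 0" if "m \<noteq> n" for m n u v
    by (rule closure_span_orthogonal[OF _ V(2) V(2)]) (use that in \<open>auto simp: inner_basis\<close>)
  then show ?thesis
    using that[of V] V(1) by simp
qed

text \<open>In the lemmas below a kernel on \<open>X\<close> is realized by a map \<open>\<Psi>\<close> if its value at \<open>(x, y)\<close> is
  \<open>\<Psi> x \<bullet> \<Psi> y\<close>. Realizable kernels are closed under convergent sums, products (by expanding one
  factor with Parseval's identity), powers, and power series with nonnegative coefficients.\<close>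

lemma sum_kernel:
  fixes \<Phi> :: "nat \<Rightarrow> 'x \<Rightarrow> 'a"
  assumes "\<And>x. x \<in> X \<Longrightarrow> summable (\<lambda>n. (norm (\<Phi> n x))\<^sup>2)"
  shows "\<exists>\<Psi> :: 'x \<Rightarrow> 'a. \<forall>x\<in>X. \<forall>y\<in>X. (\<lambda>n. \<Phi> n x \<bullet> \<Phi> n y) sums (\<Psi> x \<bullet> \<Psi> y)"
proof -
  obtain V :: "nat \<Rightarrow> 'a \<Rightarrow> 'a"
    where V: "\<And>m n u v. V m u \<bullet> V n v = (if m = n then u \<bullet> v else 0)"
    using orthogonal_copies by blast
  have sm: "summable (\<lambda>n. V n (\<Phi> n x))" if "x \<in> X" for x
    by (rule orthogonal_series) (use assms[OF that] V in \<open>auto simp: power2_norm_eq_inner\<close>)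
  have "(\<lambda>n. \<Phi> n x \<bullet> \<Phi> n y) sums ((\<Sum>n. V n (\<Phi> n x)) \<bullet> (\<Sum>n. V n (\<Phi> n y)))"
    if "x \<in> X" "y \<in> X" for x y
    using orthogonal_series_inner[OF sm[OF that(1)] sm[OF that(2)]] by (simp add: V)
  then show ?thesis
    by (intro exI[of _ "\<lambda>x. \<Sum>n. V n (\<Phi> n x)"]) blast
qed

lemma product_kernel:
  fixes \<Phi> \<Psi> :: "'x \<Rightarrow> 'a"
  shows "\<exists>\<Theta> :: 'x \<Rightarrow> 'a. \<forall>x y. \<Theta> x \<bullet> \<Theta> y = (\<Phi> x \<bullet> \<Phi> y) * (\<Psi> x \<bullet> \<Psi> y)"
proof -
  have *: "(\<lambda>n. ((\<Phi> x \<bullet> e n) *\<^sub>R \<Psi> x) \<bullet> ((\<Phi> y \<bullet> e n) *\<^sub>R \<Psi> y)) sums ((\<Phi> x \<bullet> \<Phi> y) * (\<Psi> x \<bullet> \<Psi> y))" for x y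
    using sums_mult2[OF Parseval[of "\<Phi> x" "\<Phi> y"], of "\<Psi> x \<bullet> \<Psi> y"] by (simp add: mult_ac)
  have "\<exists>\<Theta> :: 'x \<Rightarrow> 'a. \<forall>x\<in>UNIV. \<forall>y\<in>UNIV. (\<lambda>n. ((\<Phi> x \<bullet> e n) *\<^sub>R \<Psi> x) \<bullet> ((\<Phi> y \<bullet> e n) *\<^sub>R \<Psi> y)) sums (\<Theta> x \<bullet> \<Theta> y)"
    by (rule sum_kernel[of UNIV "\<lambda>n x. (\<Phi> x \<bullet> e n) *\<^sub>R \<Psi> x"])
       (use sums_summable[OF *] in \<open>simp only: power2_norm_eq_inner\<close>)
  then obtain \<Theta> :: "'x \<Rightarrow> 'a" where \<Theta>:
    "\<And>x y. (\<lambda>n. ((\<Phi> x \<bullet> e n) *\<^sub>R \<Psi> x) \<bullet> ((\<Phi> y \<bullet> e n) *\<^sub>R \<Psi> y)) sums (\<Theta> x \<bullet> \<Theta> y)"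
    by blast
  show ?thesis
    using sums_unique2[OF \<Theta> *] by blast
qed

lemma power_kernel:
  fixes \<Phi> :: "'x \<Rightarrow> 'a"
  shows "\<exists>\<Theta> :: 'x \<Rightarrow> 'a. \<forall>x y. \<Theta> x \<bullet> \<Theta> y = (\<Phi> x \<bullet> \<Phi> y) ^ n"
proof (induction n)
  case 0
  show ?case
    by (rule exI[of _ "\<lambda>_. e 0"]) (simp add: inner_basis)
next
  case (Suc n)
  then obtain \<Theta> :: "'x \<Rightarrow> 'a" where "\<forall>x y. \<Theta> x \<bullet> \<Theta> y = (\<Phi> x \<bullet> \<Phi> y) ^ n"
    by blast
  then show ?case
    using product_kernel[of \<Phi> \<Theta>] by simp
qed

lemma power_series_kernel:
  fixes \<Phi> :: "'x \<Rightarrow> 'a"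
  assumes "\<And>n. a n \<ge> 0" and "\<And>x. x \<in> X \<Longrightarrow> summable (\<lambda>n. a n * (\<Phi> x \<bullet> \<Phi> x) ^ n)"
  shows "\<exists>\<Psi> :: 'x \<Rightarrow> 'a. \<forall>x\<in>X. \<forall>y\<in>X. (\<lambda>n. a n * (\<Phi> x \<bullet> \<Phi> y) ^ n) sums (\<Psi> x \<bullet> \<Psi> y)"
proof -
  obtain \<Theta> :: "nat \<Rightarrow> 'x \<Rightarrow> 'a" where \<Theta>: "\<And>n x y. \<Theta> n x \<bullet> \<Theta> n y = (\<Phi> x \<bullet> \<Phi> y) ^ n"
    using power_kernel[of \<Phi>] by metis
  have eq: "(sqrt (a n) *\<^sub>R \<Theta> n x) \<bullet> (sqrt (a n) *\<^sub>R \<Theta> n y) = a n * (\<Phi> x \<bullet> \<Phi> y) ^ n" for n x y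
    using assms(1)[of n] by (simp add: \<Theta> flip: mult.assoc)
  show ?thesis
    using sum_kernel[of X "\<lambda>n x. sqrt (a n) *\<^sub>R \<Theta> n x"] assms(2)
    by (simp only: eq power2_norm_eq_inner)
qed

end

text \<open>The coefficients are those of the binomial series up to sign. For \<open>n > 0\<close> they are
  \<open>t (1 - t) (2 - t) \<dots> (n - 1 - t) / n!\<close>, which is where the condition \<open>t \<le> 1\<close> enters.\<close>

lemma one_minus_powr_series:
  fixes t :: real
  assumes "0 < t" "t \<le> 1"
  obtains a :: "nat \<Rightarrow> real" where "\<And>n. a n \<ge> 0"
    "\<And>z. \<bar>z\<bar> < 1 \<Longrightarrow> (\<lambda>n. a n * z ^ n) sums (1 - (1 - z) powr t)"
proof -
  define a where "a n = (if n = 0 then 0 else - ((- 1) ^ n * (t gchoose n)))" for n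
  have "a n \<ge> 0" for n
  proof (cases n)
    case (Suc m)
    have "(- 1) ^ n * (t gchoose n) = pochhammer (- t) n / fact n"
      by (simp add: gbinomial_pochhammer flip: power_add mult_2 mult.assoc)
    also have "\<dots> = - (t * pochhammer (1 - t) m / fact n)"
      by (simp add: Suc pochhammer_rec)
    finally have "a n = t * pochhammer (1 - t) m / fact n"
      by (simp add: a_def Suc)
    moreover have "pochhammer (1 - t) m \<ge> 0"
      unfolding pochhammer_prod using assms by (intro prod_nonneg) auto
    ultimately show ?thesis
      using assms by simp
  qed (simp add: a_def)
  moreover have "(\<lambda>n. a n * z ^ n) sums (1 - (1 - z) powr t)" if "\<bar>z\<bar> < 1" for z
  proof -
    have "(\<lambda>n. (t gchoose n) * (- z) ^ n) sums ((1 + - z) powr t)"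
      by (rule gen_binomial_real) (use that in simp)
    from sums_diff[OF sums_single[of 0 "\<lambda>_. 1"] this]
    have "(\<lambda>n. (if n = 0 then 1 else 0) - (t gchoose n) * (- z) ^ n) sums (1 - (1 - z) powr t)"
      by simp
    moreover have "(\<lambda>n. (if n = 0 then 1 else 0) - (t gchoose n) * (- z) ^ n) = (\<lambda>n. a n * z ^ n)"
      by (rule ext) (simp add: a_def power_minus[of z])
    ultimately show ?thesis
      by simp
  qed
  ultimately show ?thesis
    by (rule that)
qed

section \<open>Hyperbolic geometry\<close>

lemma hyp_fst_sq: "x \<in> hyp \<Longrightarrow> (fst x)\<^sup>2 = 1 + (norm (snd x))\<^sup>2"
  by (simp add: hyp_def lorentz_form_def power2_eq_square dot_square_norm)

lemma hyp_fst_pos: "x \<in> hyp \<Longrightarrow> fst x > 0"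
  by (simp add: hyp_def)

lemma lorentz_self: "x \<in> hyp \<Longrightarrow> lorentz_form x x = 1"
  by (simp add: hyp_def)

lemma origin_in_hyp: "(1, 0) \<in> hyp"
  by (simp add: hyp_def lorentz_form_def)

lemma lorentz_origin: "lorentz_form v (1, 0) = fst v" "lorentz_form (1, 0) v = fst v"
  by (simp_all add: lorentz_form_def)

lemma inner_eq_lorentz: "v \<bullet> w = 2 * (fst v * fst w) - lorentz_form v w"
  by (simp add: lorentz_form_def inner_prod_def)

lemma norm_sq_lorentz: "(norm v)\<^sup>2 = 2 * (fst v)\<^sup>2 - lorentz_form v v"
  using inner_eq_lorentz[of v v] by (simp add: dot_square_norm power2_eq_square)

lemma lorentz_minus: "lorentz_form (- v) w = - lorentz_form v w" "lorentz_form v (- w) = - lorentz_form v w"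
  by (simp_all add: lorentz_form_def)

lemma lorentz_eq_1_iff:
  assumes "x \<in> hyp" "y \<in> hyp"
  shows "lorentz_form x y = 1 \<longleftrightarrow> x = y"
  using Metric_space.zero[OF Metric_space_hyp assms] assms lorentz_hyp_ge_1[OF assms]
  by (simp add: hyp_dist_def)

subsection \<open>Convergence\<close>

lemma tendsto_lorentz [tendsto_intros]:
  "(f \<longlongrightarrow> v) F \<Longrightarrow> (g \<longlongrightarrow> w) F \<Longrightarrow> ((\<lambda>i. lorentz_form (f i) (g i)) \<longlongrightarrow> lorentz_form v w) F"
  unfolding lorentz_form_def by (intro tendsto_intros)

text \<open>The form controls the difference of first coordinates through the triangle inequality for
  \<open>hyp_dist\<close> with the point \<open>(1, 0)\<close>, and these together control the Hilbert norm.\<close>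

lemma hyp_tendsto_iff:
  assumes x: "x \<in> hyp" and y: "\<forall>\<^sub>F i in F. y i \<in> hyp"
  shows "(y \<longlongrightarrow> x) F \<longleftrightarrow> ((\<lambda>i. lorentz_form (y i) x) \<longlongrightarrow> 1) F"
proof
  assume "(y \<longlongrightarrow> x) F"
  then show "((\<lambda>i. lorentz_form (y i) x) \<longlongrightarrow> 1) F"
    using tendsto_lorentz[OF _ tendsto_const, of y x F x] by (simp add: lorentz_self[OF x])
next
  interpret M: Metric_space "hyp :: (real \<times> 'a) set" hyp_dist
    by (rule Metric_space_hyp)
  assume *: "((\<lambda>i. lorentz_form (y i) x) \<longlongrightarrow> 1) F"
  have "((\<lambda>i. arcosh (lorentz_form (y i) x)) \<longlongrightarrow> arcosh 1) F"
    by (rule tendsto_arcosh_strong[OF *])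
       (use y in \<open>auto elim!: eventually_mono simp: lorentz_hyp_ge_1 x\<close>)
  then have d0: "((\<lambda>i. hyp_dist (y i) x) \<longlongrightarrow> 0) F"
    by (rule Lim_transform_eventually[THEN tendsto_eq_rhs])
       (use y in \<open>auto elim!: eventually_mono simp: hyp_dist_def x\<close>)
  have "((\<lambda>i. hyp_dist (y i) (1, 0) - hyp_dist x (1, 0)) \<longlongrightarrow> 0) F"
  proof (rule Lim_null_comparison[OF _ d0])
    show "\<forall>\<^sub>F i in F. norm (hyp_dist (y i) (1, 0) - hyp_dist x (1, 0)) \<le> hyp_dist (y i) x"
      using y
    proof eventually_elim
      case (elim i)
      then show ?case
        using M.triangle[OF elim x origin_in_hyp] M.triangle[OF x elim origin_in_hyp] M.commute[of x "y i"]
        by (simp add: abs_le_iff)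
    qed
  qed
  then have "((\<lambda>i. hyp_dist (y i) (1, 0)) \<longlongrightarrow> hyp_dist x (1, 0)) F"
    by (simp add: LIM_zero_cancel)
  then have "((\<lambda>i. cosh (hyp_dist (y i) (1, 0))) \<longlongrightarrow> cosh (hyp_dist x (1, 0))) F"
    by (intro tendsto_intros)
  then have fst: "((\<lambda>i. fst (y i)) \<longlongrightarrow> fst x) F"
    by (rule Lim_transform_eventually[THEN tendsto_eq_rhs])
       (use y x in \<open>auto elim!: eventually_mono simp: cosh_hyp_dist origin_in_hyp lorentz_origin\<close>)
  have "((\<lambda>i. 2 * (fst (y i) - fst x)\<^sup>2 + 2 * (lorentz_form (y i) x - 1)) \<longlongrightarrow> 2 * (fst x - fst x)\<^sup>2 + 2 * (1 - 1)) F"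
    by (intro tendsto_intros fst *)
  moreover have "\<forall>\<^sub>F i in F. 2 * (fst (y i) - fst x)\<^sup>2 + 2 * (lorentz_form (y i) x - 1) = (norm (y i - x))\<^sup>2"
    using y by eventually_elim
      (simp add: norm_sq_lorentz lorentz_simps lorentz_self x lorentz_commute[of x "y _"])
  ultimately have "((\<lambda>i. (norm (y i - x))\<^sup>2) \<longlongrightarrow> 2 * (fst x - fst x)\<^sup>2 + 2 * (1 - 1)) F"
    by (rule Lim_transform_eventually)
  from tendsto_real_sqrt[OF this] have "((\<lambda>i. norm (y i - x)) \<longlongrightarrow> 0) F"
    by simp
  then show "(y \<longlongrightarrow> x) F"
    by (simp add: tendsto_norm_zero_iff LIM_zero_cancel)
qed

lemma hyp_topology_eq: "hyp_topology = top_of_set hyp"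
proof -
  interpret M: Metric_space "hyp :: (real \<times> 'a) set" hyp_dist
    by (rule Metric_space_hyp)
  have lim: "limitin M.mtopology f x F \<longleftrightarrow> limitin (top_of_set hyp) f x F"
    if ev: "\<forall>\<^sub>F i in F. f i \<in> hyp" and x: "x \<in> hyp" for x F and f :: "'i \<Rightarrow> real \<times> 'a"
  proof -
    have "((\<lambda>i. hyp_dist (f i) x) \<longlongrightarrow> 0) F \<longleftrightarrow> ((\<lambda>i. lorentz_form (f i) x) \<longlongrightarrow> 1) F"
    proof
      assume "((\<lambda>i. hyp_dist (f i) x) \<longlongrightarrow> 0) F"
      then have "((\<lambda>i. cosh (hyp_dist (f i) x)) \<longlongrightarrow> cosh 0) F"
        by (intro tendsto_intros)
      then show "((\<lambda>i. lorentz_form (f i) x) \<longlongrightarrow> 1) F"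
        by (rule Lim_transform_eventually[THEN tendsto_eq_rhs])
           (use ev in \<open>auto elim!: eventually_mono simp: cosh_hyp_dist x\<close>)
    next
      assume *: "((\<lambda>i. lorentz_form (f i) x) \<longlongrightarrow> 1) F"
      have "((\<lambda>i. arcosh (lorentz_form (f i) x)) \<longlongrightarrow> arcosh 1) F"
        by (rule tendsto_arcosh_strong[OF *])
           (use ev in \<open>auto elim!: eventually_mono simp: lorentz_hyp_ge_1 x\<close>)
      then show "((\<lambda>i. hyp_dist (f i) x) \<longlongrightarrow> 0) F"
        by (rule Lim_transform_eventually[THEN tendsto_eq_rhs])
           (use ev in \<open>auto elim!: eventually_mono simp: hyp_dist_def x\<close>)
    qed
    then show ?thesis
      using ev x hyp_tendsto_iff[OF x ev] by (simp add: M.limitin_metric_dist_null limitin_subtopology)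
  qed
  have "continuous_map M.mtopology (top_of_set hyp) (\<lambda>x. x)"
    unfolding continuous_map_atin
  proof
    fix x :: "real \<times> 'a" assume x: "x \<in> topspace M.mtopology"
    have "limitin M.mtopology (\<lambda>x. x) x (atin M.mtopology x)"
      using continuous_map_id[of M.mtopology] x unfolding continuous_map_atin id_def by blast
    moreover have "\<forall>\<^sub>F i in atin M.mtopology x. i \<in> hyp"
      by (rule eventually_atin[THEN iffD2]) (use x in auto)
    ultimately show "limitin (top_of_set hyp) (\<lambda>x. x) x (atin M.mtopology x)"
      using lim[of "\<lambda>x. x"] x by simp
  qed
  moreover have "continuous_map (top_of_set hyp) M.mtopology (\<lambda>x. x)"
    unfolding continuous_map_atin
  proof
    fix x :: "real \<times> 'a" assume x: "x \<in> topspace (top_of_set hyp)"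
    have "limitin (top_of_set hyp) (\<lambda>x. x) x (atin (top_of_set hyp) x)"
      using continuous_map_id[of "top_of_set hyp"] x unfolding continuous_map_atin id_def by blast
    moreover have "\<forall>\<^sub>F i in atin (top_of_set hyp) x. i \<in> hyp"
      by (rule eventually_atin[THEN iffD2]) (use x in auto)
    ultimately show "limitin M.mtopology (\<lambda>x. x) x (atin (top_of_set hyp) x)"
      using lim[of "\<lambda>x. x"] x by simp
  qed
  ultimately show ?thesis
    using homeomorphic_map_id[of M.mtopology "top_of_set hyp"]
      homeomorphic_maps_imp_map[of M.mtopology "top_of_set hyp" id id]
    by (simp add: homeomorphic_maps_def id_def)
qed

subsection \<open>Lorentz transformations and reflections\<close>

text \<open>Two vectors of square \<open>1\<close> lie on the same sheet of the hyperboloid as soon as their product is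
  positive; hence one point suffices to see that the sheet is preserved.\<close>

lemma lorentz_preserving_hyp:
  assumes T: "\<And>v w. lorentz_form (T v) (T w) = lorentz_form v w"
    and p: "p \<in> hyp" "T p \<in> hyp" and x: "x \<in> hyp"
  shows "T x \<in> hyp"
proof -
  have 1: "lorentz_form (T x) (T x) = 1" and 2: "lorentz_form (T x) (T p) \<ge> 1"
    using x p by (simp_all add: T lorentz_self lorentz_hyp_ge_1)
  then have "(fst (T x))\<^sup>2 = 1 + (norm (snd (T x)))\<^sup>2"
    by (simp add: lorentz_form_def power2_eq_square dot_square_norm)
  then have "fst (T x) \<noteq> 0"
    using power_zero_numeral zero_le_power2[of "norm (snd (T x))"] by (metis add_nonneg_eq_0_iff zero_le_one zero_neq_one)
  moreover have False if "fst (T x) < 0"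
  proof -
    have "- T x \<in> hyp"
      using that 1 by (simp add: hyp_def lorentz_minus)
    then show False
      using lorentz_hyp_ge_1[of "- T x" "T p"] p 2 by (simp add: lorentz_minus)
  qed
  ultimately show ?thesis
    using 1 unfolding hyp_def by force
qed

lemma lorentz_plusI:
  assumes T: "linear T" "bij T" "\<And>v w. lorentz_form (T v) (T w) = lorentz_form v w"
    and p: "p \<in> hyp" "T p \<in> hyp"
  shows "T \<in> lorentz_plus"
proof -
  have "T ` hyp = hyp"
  proof
    show "T ` hyp \<subseteq> hyp"
      using lorentz_preserving_hyp[of T p] T(3) p by blast
    show "hyp \<subseteq> T ` hyp"
    proof
      fix x :: "real \<times> 'a" assume x: "x \<in> hyp"
      have inv: "T (inv_into UNIV T y) = y" for y
        using T(2) by (simp add: bij_is_surj surj_f_inv_f)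
      have "lorentz_form (inv_into UNIV T v) (inv_into UNIV T w) = lorentz_form v w" for v w
        using T(3)[of "inv_into UNIV T v" "inv_into UNIV T w"] by (simp add: inv)
      moreover have "inv_into UNIV T (T p) \<in> hyp"
        using p T(2) by (simp add: bij_is_inj)
      ultimately have "inv_into UNIV T x \<in> hyp"
        using lorentz_preserving_hyp[of "inv_into UNIV T" "T p" x] p x by blast
      then show "x \<in> T ` hyp"
        using inv[of x] by (metis imageI)
    qed
  qed
  then show ?thesis
    using T by (simp add: lorentz_plus_def)
qed

text \<open>The reflection in the hyperplane orthogonal to \<open>n\<close> for the Lorentz form. For isotropic \<open>n\<close> the
  division by zero makes it the identity, so that \<open>n = p - q\<close> needs no exception for \<open>p = q\<close>.\<close>

definition lorentz_reflection :: "real \<times> 'h::real_inner \<Rightarrow> real \<times> 'h \<Rightarrow> real \<times> 'h"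
  where "lorentz_reflection n v = v - (2 * lorentz_form v n / lorentz_form n n) *\<^sub>R n"

lemma linear_lorentz_reflection: "linear (lorentz_reflection n)"
  by (rule linearI)
     (simp_all add: lorentz_reflection_def lorentz_simps algebra_simps add_divide_distrib)

lemma lorentz_reflection_involutive [simp]: "lorentz_reflection n (lorentz_reflection n v) = v"
  by (cases "lorentz_form n n = 0") (simp_all add: lorentz_reflection_def lorentz_simps algebra_simps)

lemma bij_lorentz_reflection: "bij (lorentz_reflection n)"
  by (rule o_bij[of "lorentz_reflection n"]) (auto simp: fun_eq_iff)

lemma lorentz_reflection_preserves:
  "lorentz_form (lorentz_reflection n v) (lorentz_reflection n w) = lorentz_form v w"
  by (cases "lorentz_form n n = 0")
     (simp_all add: lorentz_reflection_def lorentz_simps field_simps lorentz_commute[of n w])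

lemma lorentz_reflection_swaps:
  assumes p: "p \<in> hyp" and q: "q \<in> hyp"
  shows "lorentz_reflection (p - q) p = q"
proof (cases "lorentz_form p q = 1")
  case True
  then show ?thesis
    using lorentz_eq_1_iff[OF p q] by (simp add: lorentz_reflection_def)
next
  case False
  then have "2 * lorentz_form p (p - q) / lorentz_form (p - q) (p - q) = 1"
    by (simp add: lorentz_simps lorentz_self p q lorentz_commute[of q p] field_simps)
  then show ?thesis
    by (simp add: lorentz_reflection_def)
qed

lemma lorentz_reflection_plus:
  assumes "p \<in> hyp" "q \<in> hyp"
  shows "lorentz_reflection (p - q) \<in> lorentz_plus"
  by (rule lorentz_plusI[of _ p])
     (use assms in \<open>auto simp: linear_lorentz_reflection bij_lorentz_reflection
        lorentz_reflection_preserves lorentz_reflection_swaps\<close>)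

lemma restrict_lorentz_plus:
  assumes "T \<in> lorentz_plus"
  shows "restrict T hyp \<in> hyp_isom"
proof -
  have T: "bij T" "T ` hyp = hyp" "\<And>v w. lorentz_form (T v) (T w) = lorentz_form v w"
    using assms by (auto simp: lorentz_plus_def)
  then have "bij_betw (restrict T hyp) hyp hyp"
    by (auto simp: bij_betw_def inj_on_def bij_def)
  moreover have "T x \<in> hyp" if "x \<in> hyp" for x
    using T(2) that by blast
  moreover from this have "hyp_dist (T x) (T y) = hyp_dist x y" if "x \<in> hyp" "y \<in> hyp" for x y
    using that by (simp add: hyp_dist_def T(3))
  ultimately show ?thesis
    by (simp add: hyp_isom_def Bij_def)
qed

section \<open>The power map\<close>

text \<open>In the coordinate \<open>k x = snd x / fst x\<close> of the projective ball model,
  \<open>lorentz_form x y = fst x * fst y * (1 - k x \<bullet> k y)\<close>, so that the kernel below is a rescaling of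
  \<open>1 - (1 - z) powr t\<close> evaluated at \<open>z = k x \<bullet> k y\<close>.\<close>

lemma (in orthonormal_basis) powr_lorentz_kernel:
  fixes t :: real
  assumes "0 < t" "t \<le> 1"
  shows "\<exists>F :: real \<times> 'a \<Rightarrow> 'a. \<forall>x\<in>hyp. \<forall>y\<in>hyp.
    F x \<bullet> F y = fst x powr t * fst y powr t - lorentz_form x y powr t"
proof -
  define k where "k x = snd x /\<^sub>R fst x" for x :: "real \<times> 'a"
  obtain a where a: "\<And>n. a n \<ge> 0"
    "\<And>z. \<bar>z\<bar> < 1 \<Longrightarrow> (\<lambda>n. a n * z ^ n) sums (1 - (1 - z) powr t)"
    using one_minus_powr_series[OF assms] by blast
  have nk: "norm (k x) < 1" if "x \<in> hyp" for x
  proof -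
    have "(norm (snd x))\<^sup>2 < (fst x)\<^sup>2"
      using hyp_fst_sq[OF that] by simp
    then have "norm (snd x) < fst x"
      by (rule power2_less_imp_less) (simp add: hyp_fst_pos that less_imp_le)
    then show ?thesis
      using hyp_fst_pos[OF that] by (simp add: k_def divide_simps)
  qed
  have kk: "\<bar>k x \<bullet> k y\<bar> < 1" if "x \<in> hyp" "y \<in> hyp" for x y
  proof -
    have "norm (k x) * norm (k y) < 1"
      using mult_strict_mono[OF nk[OF that(1)] nk[OF that(2)]] by simp
    then show ?thesis
      using Cauchy_Schwarz_ineq2[of "k x" "k y"] by linarith
  qed
  obtain \<Psi> :: "real \<times> 'a \<Rightarrow> 'a"
    where \<Psi>: "\<And>x y. x \<in> hyp \<Longrightarrow> y \<in> hyp \<Longrightarrow> (\<lambda>n. a n * (k x \<bullet> k y) ^ n) sums (\<Psi> x \<bullet> \<Psi> y)"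
    using power_series_kernel[of a hyp k] a kk sums_summable by metis
  have \<Psi>_inner: "\<Psi> x \<bullet> \<Psi> y = 1 - (1 - k x \<bullet> k y) powr t" if "x \<in> hyp" "y \<in> hyp" for x y
    using sums_unique2[OF \<Psi>[OF that] a(2)[OF kk[OF that]]] .
  have "(fst x powr t *\<^sub>R \<Psi> x) \<bullet> (fst y powr t *\<^sub>R \<Psi> y)
      = fst x powr t * fst y powr t - lorentz_form x y powr t" if xy: "x \<in> hyp" "y \<in> hyp" for x y
  proof -
    have pos: "fst x > 0" "fst y > 0"
      using xy[THEN hyp_fst_pos] .
    have "lorentz_form x y = fst x * fst y * (1 - k x \<bullet> k y)"
      using pos by (simp add: lorentz_form_def k_def field_simps)
    then have "lorentz_form x y powr t = fst x powr t * fst y powr t * (1 - k x \<bullet> k y) powr t"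
      using pos kk[OF xy] by (simp add: powr_mult)
    then show ?thesis
      by (simp add: \<Psi>_inner[OF xy] algebra_simps)
  qed
  then show ?thesis
    by (intro exI[of _ "\<lambda>x. fst x powr t *\<^sub>R \<Psi> x"] ballI)
qed

lemma separable_isometry_onto:
  fixes K :: "'a::{real_inner, complete_space} set"
  assumes sep: "separable_space (euclidean :: 'a topology)"
    and inf: "\<nexists>S. finite S \<and> K \<subseteq> span S" and K: "subspace K" "closed K"
  obtains U :: "'a \<Rightarrow> 'a" where "linear U" "\<And>v w. U v \<bullet> U w = v \<bullet> w" "range U = K"
proof -
  have inf_UNIV: "\<nexists>S. finite S \<and> (UNIV :: 'a set) \<subseteq> span S"
    using inf by blast
  obtain e :: "nat \<Rightarrow> 'a" where e: "\<And>i j. e i \<bullet> e j = (if i = j then 1 else 0)"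
      "\<And>u. (\<And>i. u \<bullet> e i = 0) \<Longrightarrow> u = 0"
    using orthonormal_sequence_exists[OF sep inf_UNIV subspace_UNIV] by (metis UNIV_I)
  obtain k :: "nat \<Rightarrow> 'a" where k: "\<And>i j. k i \<bullet> k j = (if i = j then 1 else 0)" "range k \<subseteq> K"
      "\<And>u. u \<in> K \<Longrightarrow> (\<And>i. u \<bullet> k i = 0) \<Longrightarrow> u = 0"
    using orthonormal_sequence_exists[OF sep inf K(1)] by blast
  have tot: "u = 0" if "\<And>i. i \<in> UNIV \<Longrightarrow> u \<bullet> e i = 0" for u
    by (rule e(2)) (use that in simp)
  show ?thesis
  proof (rule isometry_of_Gram[where X=UNIV and \<phi>=e and \<psi>=k, OF _ tot])
    fix U :: "'a \<Rightarrow> 'a"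
    assume U: "linear U" "\<And>v w. U v \<bullet> U w = v \<bullet> w" "\<And>i. i \<in> UNIV \<Longrightarrow> U (e i) = k i"
      "closed (range U)" "range U \<subseteq> closure (span (range k))"
    have sub: "subspace (range U)"
      by (intro linear_subspace_image U subspace_UNIV)
    have "closure (span (range k)) \<subseteq> K"
      by (intro closure_minimal span_minimal k K)
    then have "range U \<subseteq> K"
      using U(5) by blast
    moreover have "x \<in> range U" if x: "x \<in> K" for x
    proof -
      obtain p where p: "p \<in> range U" "\<And>v. v \<in> range U \<Longrightarrow> (x - p) \<bullet> v = 0"
        using orthogonal_projection_exists[OF sub U(4)] by blast
      have "k i \<in> range U" for i
        using U(3)[of i] by (metis rangeI UNIV_I)
      moreover have "x - p \<in> K"
        using x p(1) \<open>range U \<subseteq> K\<close> K(1) subspace_diff by blast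
      ultimately have "x - p = 0"
        using k(3) p(2) by blast
      then show ?thesis
        using p(1) by simp
    qed
    ultimately show ?thesis
      using that[OF U(1,2)] by blast
  qed (use e(1) k(1) in simp_all)
qed

text \<open>The last property says that the image is total. To achieve it, the closed span \<open>K\<close> of the image
  of a realization \<open>F\<close> of the kernel is identified with the whole Hilbert space; both have a countably
  infinite orthonormal basis.\<close>

theorem lorentz_power_map_exists:
  fixes t :: real
  assumes sep: "separable_space (euclidean :: 'h::{real_inner, complete_space} topology)"
    and inf: "\<nexists>S :: 'h::{real_inner, complete_space} set. finite S \<and> span S = UNIV"
    and t: "0 < t" "t \<le> 1"
  obtains f :: "real \<times> 'h::{real_inner, complete_space} \<Rightarrow> real \<times> 'h" where
    "\<And>x y. x \<in> hyp \<Longrightarrow> y \<in> hyp \<Longrightarrow> lorentz_form (f x) (f y) = lorentz_form x y powr t"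
    "\<And>x. x \<in> hyp \<Longrightarrow> fst (f x) = fst x powr t"
    "\<And>u. (\<And>x. x \<in> hyp \<Longrightarrow> lorentz_form u (f x) = 0) \<Longrightarrow> u = 0"
proof -
  have inf_UNIV: "\<nexists>S. finite S \<and> (UNIV :: 'h set) \<subseteq> span S"
    using inf by (metis top.extremum_uniqueI)
  obtain e :: "nat \<Rightarrow> 'h" where e: "\<And>i j. e i \<bullet> e j = (if i = j then 1 else 0)"
      "\<And>u. (\<And>i. u \<bullet> e i = 0) \<Longrightarrow> u = 0"
    using orthonormal_sequence_exists[OF sep inf_UNIV subspace_UNIV] by (metis UNIV_I)
  interpret orthonormal_basis e
    by unfold_locales (fact e)+
  obtain F :: "real \<times> 'h \<Rightarrow> 'h" where F: "\<And>x y. x \<in> hyp \<Longrightarrow> y \<in> hyp \<Longrightarrow>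
      F x \<bullet> F y = fst x powr t * fst y powr t - lorentz_form x y powr t"
    using powr_lorentz_kernel[OF t] by blast
  define K where "K = closure (span (F ` hyp))"
  have K: "subspace K" "closed K"
    by (simp_all add: K_def subspace_closure)
  have FK: "F x \<in> K" if "x \<in> hyp" for x
    unfolding K_def using that by (intro subsetD[OF closure_subset] span_base) blast
  \<comment> \<open>\<open>F\<close> sends the points \<open>(\<surd>2, e\<^sub>i)\<close> to nonzero pairwise orthogonal vectors\<close>
  define x where "x i = (sqrt 2, e i)" for i
  have x: "x i \<in> hyp" for i
    by (simp add: x_def hyp_def lorentz_form_def e(1))
  have Fx: "F (x i) \<bullet> F (x j) = (if i = j then 2 powr t - 1 else 0)" for i j
    using F[OF x x, of i j] by (simp add: x_def lorentz_form_def e(1) flip: powr_mult)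
  have pos: "2 powr t > 1"
    using t by simp
  have inj: "inj (\<lambda>i. F (x i))"
  proof (rule injI)
    fix i j assume "F (x i) = F (x j)"
    then have "F (x i) \<bullet> F (x j) = F (x i) \<bullet> F (x i)"
      by simp
    then show "i = j"
      using pos by (simp add: Fx split: if_splits)
  qed
  have "independent (range (\<lambda>i. F (x i)))"
  proof (rule pairwise_orthogonal_independent)
    show "pairwise orthogonal (range (\<lambda>i. F (x i)))"
      by (auto simp: pairwise_def orthogonal_def Fx)
    have "F (x i) \<noteq> 0" for i
      using Fx[of i i] pos by force
    then show "0 \<notin> range (\<lambda>i. F (x i))"
      by (metis imageE)
  qed
  moreover have "range (\<lambda>i. F (x i)) \<subseteq> K"
    using FK x by blast
  ultimately have inf_K: "\<nexists>S. finite S \<and> K \<subseteq> span S"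
    using independent_span_bound[of _ "range (\<lambda>i. F (x i))"] range_inj_infinite[OF inj] by blast
  obtain U :: "'h \<Rightarrow> 'h" where U: "linear U" "\<And>v w. U v \<bullet> U w = v \<bullet> w" "range U = K"
    using separable_isometry_onto[OF sep inf_K K] by blast
  have "\<exists>v. U v = F x" if "x \<in> hyp" for x
    using FK[OF that] U(3) by (metis imageE)
  then obtain \<psi> where \<psi>: "\<And>x. x \<in> hyp \<Longrightarrow> U (\<psi> x) = F x"
    by metis
  have \<psi>_inner: "\<psi> x \<bullet> \<psi> y = fst x powr t * fst y powr t - lorentz_form x y powr t"
    if "x \<in> hyp" "y \<in> hyp" for x y
    using F[OF that] U(2)[of "\<psi> x" "\<psi> y"] \<psi> that by simp
  have \<psi>_total: "u = 0" if u: "\<And>x. x \<in> hyp \<Longrightarrow> u \<bullet> \<psi> x = 0" for u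
  proof -
    have "U u \<bullet> U u = 0"
    proof (rule closure_span_orthogonal[of "F ` hyp" "{U u}"])
      show "a \<bullet> b = 0" if ab: "a \<in> F ` hyp" "b \<in> {U u}" for a b
      proof -
        obtain y where y: "y \<in> hyp" "a = F y"
          using ab(1) by blast
        have "F y \<bullet> U u = u \<bullet> \<psi> y"
          unfolding \<psi>[OF y(1), symmetric] U(2) by (rule inner_commute)
        then show ?thesis
          using ab(2) y(2) u[OF y(1)] by simp
      qed
      show "U u \<in> closure (span (F ` hyp))"
        using rangeI[of U u] unfolding U(3) K_def .
      show "U u \<in> closure (span {U u})"
        by (intro subsetD[OF closure_subset] span_base) simp
    qed
    then show ?thesis
      unfolding U(2) by simp
  qed
  show ?thesis
  proof (rule that[of "\<lambda>x. (fst x powr t, \<psi> x)"])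
    show "lorentz_form (fst x powr t, \<psi> x) (fst y powr t, \<psi> y) = lorentz_form x y powr t"
      if "x \<in> hyp" "y \<in> hyp" for x y
      using \<psi>_inner[OF that] by (simp add: lorentz_form_def)
    show "u = 0" if u: "\<And>x. x \<in> hyp \<Longrightarrow> lorentz_form u (fst x powr t, \<psi> x) = 0" for u
    proof -
      have "\<psi> (1, 0) \<bullet> \<psi> (1, 0) = 0"
        using \<psi>_inner[OF origin_in_hyp origin_in_hyp] by (simp add: lorentz_form_def)
      then have "fst u = 0"
        using u[OF origin_in_hyp] by (simp add: lorentz_form_def)
      moreover have "snd u = 0"
        by (rule \<psi>_total) (use u \<open>fst u = 0\<close> in \<open>simp add: lorentz_form_def\<close>)
      ultimately show ?thesis
        by (simp add: prod_eq_iff)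
    qed
  qed simp
qed

section \<open>The transported representation\<close>

lemma hyp_isom_mem: "g \<in> hyp_isom \<Longrightarrow> x \<in> hyp \<Longrightarrow> g x \<in> hyp"
  by (auto simp: hyp_isom_def Bij_def bij_betw_def)

lemma hyp_isom_image: "g \<in> hyp_isom \<Longrightarrow> g ` hyp = hyp"
  by (auto simp: hyp_isom_def Bij_def bij_betw_def)

lemma hyp_isom_lorentz:
  assumes "g \<in> hyp_isom" "x \<in> hyp" "y \<in> hyp"
  shows "lorentz_form (g x) (g y) = lorentz_form x y"
proof -
  have "cosh (hyp_dist (g x) (g y)) = cosh (hyp_dist x y)"
    using assms by (simp add: hyp_isom_def)
  then show ?thesis
    using assms by (simp add: cosh_hyp_dist hyp_isom_mem)
qed

lemma lorentz_plusD:
  assumes "T \<in> lorentz_plus"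
  shows "linear T" "bij T" "lorentz_form (T v) (T w) = lorentz_form v w" "T ` hyp = hyp"
    "x \<in> hyp \<Longrightarrow> T x \<in> hyp"
  using assms unfolding lorentz_plus_def by blast+

lemma lorentz_plus_compose:
  assumes "S \<in> lorentz_plus" "T \<in> lorentz_plus"
  shows "S \<circ> T \<in> lorentz_plus"
proof -
  have "(S \<circ> T) ` hyp = hyp"
    using assms by (metis image_comp lorentz_plusD(4))
  then show ?thesis
    using assms by (simp add: lorentz_plus_def linear_compose bij_comp del: split_paired_All)
qed

text \<open>A map with total image which raises the Lorentz form to the power \<open>t\<close>. The normalization of
  the first coordinate makes it fix the point \<open>(1, 0)\<close>.\<close>

locale lorentz_power_map =
  fixes f :: "real \<times> 'h::{real_inner, complete_space} \<Rightarrow> real \<times> 'h" and t :: real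
  assumes t_pos: "t > 0"
    and lorentz_f: "x \<in> hyp \<Longrightarrow> y \<in> hyp \<Longrightarrow> lorentz_form (f x) (f y) = lorentz_form x y powr t"
    and fst_f: "x \<in> hyp \<Longrightarrow> fst (f x) = fst x powr t"
    and total_f: "(\<And>x. x \<in> hyp \<Longrightarrow> lorentz_form u (f x) = 0) \<Longrightarrow> u = 0"
begin

lemma f_hyp: "x \<in> hyp \<Longrightarrow> f x \<in> hyp"
  using lorentz_f[of x x] fst_f[of x] hyp_fst_pos[of x] by (simp add: hyp_def)

lemma f_origin: "f (1, 0) = (1, 0)"
  using lorentz_eq_1_iff[OF f_hyp[OF origin_in_hyp] origin_in_hyp] fst_f[OF origin_in_hyp]
  by (simp add: lorentz_origin)

lemma inner_total_f:
  assumes "\<And>x. x \<in> hyp \<Longrightarrow> u \<bullet> f x = 0"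
  shows "u = 0"
proof -
  have "(fst u, - snd u) = 0"
    by (rule total_f) (use assms in \<open>simp add: lorentz_form_def inner_prod_def\<close>)
  then show ?thesis
    by (simp add: prod_eq_iff)
qed

lemma dense_span_f: "closure (span (f ` hyp)) = UNIV"
proof (rule closed_subspace_eq_UNIV)
  show "u = 0" if "\<And>v. v \<in> closure (span (f ` hyp)) \<Longrightarrow> u \<bullet> v = 0" for u
  proof (rule inner_total_f)
    fix x :: "real \<times> 'h" assume "x \<in> hyp"
    then have "f x \<in> closure (span (f ` hyp))"
      by (intro subsetD[OF closure_subset] span_base) blast
    then show "u \<bullet> f x = 0"
      by (rule that)
  qed
qed (simp_all add: subspace_closure)

text \<open>The families \<open>f\<close> and \<open>f \<circ> g\<close> have the same Gram matrix for the Lorentz form. After a reflection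
  \<open>S\<close> moving \<open>f (g (1, 0))\<close> back to \<open>(1, 0)\<close>, they also have the same first coordinates, hence
  the same Gram matrix for the inner product, and are related by a linear isometry \<open>U\<close>.\<close>

lemma lift_exists:
  assumes g: "g \<in> hyp_isom"
  shows "\<exists>T. T \<in> lorentz_plus \<and> (\<forall>x\<in>hyp. T (f x) = f (g x))"
proof -
  define q where "q = f (g (1, 0))"
  have q: "q \<in> hyp"
    unfolding q_def by (rule f_hyp[OF hyp_isom_mem[OF g origin_in_hyp]])
  define S where "S = lorentz_reflection (q - (1, 0))"
  have S: "S \<in> lorentz_plus" and Sq: "S q = (1, 0)" and SS: "S (S v) = v" for v
    by (simp_all add: S_def lorentz_reflection_plus lorentz_reflection_swaps q origin_in_hyp)
  define \<psi> where "\<psi> x = S (f (g x))" for x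
  have \<psi>_lorentz: "lorentz_form (\<psi> x) (\<psi> y) = lorentz_form (f x) (f y)" if "x \<in> hyp" "y \<in> hyp" for x y
    using that g by (simp add: \<psi>_def lorentz_plusD(3)[OF S] lorentz_f hyp_isom_mem hyp_isom_lorentz)
  have \<psi>_origin: "\<psi> (1, 0) = (1, 0)"
    using Sq by (simp add: \<psi>_def q_def)
  have "fst (\<psi> x) = fst (f x)" if "x \<in> hyp" for x
    using \<psi>_lorentz[OF that origin_in_hyp] by (simp add: \<psi>_origin f_origin lorentz_origin)
  then have Gram: "f x \<bullet> f y = \<psi> x \<bullet> \<psi> y" if "x \<in> hyp" "y \<in> hyp" for x y
    using that by (simp add: inner_eq_lorentz \<psi>_lorentz)
  have \<psi>_total: "u = 0" if u: "\<And>x. x \<in> hyp \<Longrightarrow> u \<bullet> \<psi> x = 0" for u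
  proof -
    define w where "w = (fst u, - snd u)"
    have w: "lorentz_form w (\<psi> x) = u \<bullet> \<psi> x" for x
      by (simp add: w_def lorentz_form_def inner_prod_def)
    have "S w = 0"
    proof (rule total_f)
      fix y :: "real \<times> 'h" assume "y \<in> hyp"
      then obtain x where x: "x \<in> hyp" "y = g x"
        using hyp_isom_image[OF g] by blast
      have "lorentz_form (S w) (S (\<psi> x)) = 0"
        unfolding lorentz_plusD(3)[OF S] w using u x(1) .
      then show "lorentz_form (S w) (f y) = 0"
        by (simp add: \<psi>_def SS x(2))
    qed
    then have "w = 0"
      using SS[of w] linear_0[OF lorentz_plusD(1)[OF S]] by simp
    then show ?thesis
      by (simp add: w_def prod_eq_iff)
  qed
  show ?thesis
  proof (rule isometry_of_Gram[OF Gram inner_total_f])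
    fix U :: "real \<times> 'h \<Rightarrow> real \<times> 'h"
    assume U: "linear U" "\<And>v w. U v \<bullet> U w = v \<bullet> w" "\<And>x. x \<in> hyp \<Longrightarrow> U (f x) = \<psi> x"
      "closed (range U)"
    have "range U = UNIV"
    proof (rule closed_subspace_eq_UNIV[OF _ U(4)])
      show "subspace (range U)"
        by (intro linear_subspace_image U subspace_UNIV)
      show "u = 0" if "\<And>v. v \<in> range U \<Longrightarrow> u \<bullet> v = 0" for u
        by (rule \<psi>_total) (simp add: that flip: U(3))
    qed
    moreover have "inj U"
      unfolding linear_injective_0[OF U(1)]
    proof (intro allI impI)
      fix v assume "U v = 0"
      then show "v = 0"
        using U(2)[of v v] by simp
    qed
    ultimately have "bij U"
      by (simp add: bij_def)
    have Uo: "U (1, 0) = (1, 0)"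
      using U(3)[OF origin_in_hyp] by (simp add: f_origin \<psi>_origin)
    have "fst (U v) = fst v" for v
      using U(2)[of v "(1, 0)"] unfolding Uo by (simp add: inner_prod_def)
    then have UU: "lorentz_form (U v) (U w) = lorentz_form v w" for v w
      using U(2)[of v w] by (simp add: inner_eq_lorentz)
    have "U \<in> lorentz_plus"
      using lorentz_plusI[OF U(1) \<open>bij U\<close> UU origin_in_hyp] by (simp add: Uo origin_in_hyp)
    then have "S \<circ> U \<in> lorentz_plus"
      using S by (intro lorentz_plus_compose)
    moreover have "(S \<circ> U) (f x) = f (g x)" if "x \<in> hyp" for x
      by (simp add: U(3)[OF that] \<psi>_def SS)
    ultimately show ?thesis
      by blast
  qed
qed

lemma lorentz_plus_eqI:
  assumes S: "S \<in> lorentz_plus" and T: "T \<in> lorentz_plus"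
    and eq: "\<And>x. x \<in> hyp \<Longrightarrow> S (f x) = T (f x)"
  shows "S = T"
proof
  fix v
  obtain z where z: "S z = S v - T v"
    using lorentz_plusD(2)[OF S] by (metis bij_pointE)
  have "z = 0"
  proof (rule total_f)
    fix x :: "real \<times> 'h" assume x: "x \<in> hyp"
    have "lorentz_form z (f x) = lorentz_form (S v - T v) (S (f x))"
      by (simp add: lorentz_plusD(3)[OF S] flip: z)
    also have "\<dots> = lorentz_form (S v) (S (f x)) - lorentz_form (T v) (T (f x))"
      by (simp add: lorentz_diff_left eq[OF x])
    also have "\<dots> = 0"
      by (simp add: lorentz_plusD(3)[OF S] lorentz_plusD(3)[OF T])
    finally show "lorentz_form z (f x) = 0" .
  qed
  then show "S v = T v"
    using z linear_0[OF lorentz_plusD(1)[OF S]] by simp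
qed

text \<open>The linear Lorentz transformation through which an isometry \<open>g\<close> acts on the image of \<open>f\<close>. It is
  unique because this image is total.\<close>

definition lift :: "(real \<times> 'h \<Rightarrow> real \<times> 'h) \<Rightarrow> real \<times> 'h \<Rightarrow> real \<times> 'h"
  where "lift g = (SOME T. T \<in> lorentz_plus \<and> (\<forall>x\<in>hyp. T (f x) = f (g x)))"

text \<open>The self-representation of the isometry group: \<open>lift g\<close>, restricted to \<open>hyp\<close> as an
  extensional function.\<close>

definition rep :: "(real \<times> 'h \<Rightarrow> real \<times> 'h) \<Rightarrow> real \<times> 'h \<Rightarrow> real \<times> 'h"
  where "rep g = restrict (lift g) hyp"

lemma lift_plus: "g \<in> hyp_isom \<Longrightarrow> lift g \<in> lorentz_plus"
  and lift_f: "g \<in> hyp_isom \<Longrightarrow> x \<in> hyp \<Longrightarrow> lift g (f x) = f (g x)"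
  using someI_ex[OF lift_exists, of g] unfolding lift_def by blast+

lemma rep_isom: "g \<in> hyp_isom \<Longrightarrow> rep g \<in> hyp_isom"
  unfolding rep_def by (intro restrict_lorentz_plus lift_plus)

lemma linear_extension_rep:
  assumes g: "g \<in> hyp_isom"
  shows "linear_extension (rep g) = lift g"
  unfolding linear_extension_def
  by (rule the1_equality[OF hyp_isom_extends[OF rep_isom[OF g]]])
     (simp add: lift_plus[OF g] rep_def)

lemma carrier_hyp_isom_group: "carrier hyp_isom_group = hyp_isom"
  by (simp add: hyp_isom_group_def)

lemma mult_hyp_isom_group:
  assumes "g \<in> hyp_isom" "h \<in> hyp_isom"
  shows "g \<otimes>\<^bsub>hyp_isom_group\<^esub> h = compose hyp g h"
  using assms by (simp add: hyp_isom_group_def BijGroup_def hyp_isom_def)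

lemma lift_compose:
  assumes g: "g \<in> hyp_isom" and h: "h \<in> hyp_isom" and gh: "compose hyp g h \<in> hyp_isom"
  shows "lift (compose hyp g h) = lift g \<circ> lift h"
proof (rule lorentz_plus_eqI)
  show "lift (compose hyp g h) \<in> lorentz_plus" "lift g \<circ> lift h \<in> lorentz_plus"
    using g h gh by (simp_all add: lift_plus lorentz_plus_compose)
  show "lift (compose hyp g h) (f x) = (lift g \<circ> lift h) (f x)" if "x \<in> hyp" for x
    using that g h gh by (simp add: lift_f hyp_isom_mem compose_eq)
qed

lemma rep_hom: "rep \<in> hom hyp_isom_group hyp_isom_group"
proof -
  interpret G: group "hyp_isom_group :: (real \<times> 'h \<Rightarrow> real \<times> 'h) monoid"
    by (rule group_hyp_isom)
  have "rep (g \<otimes>\<^bsub>hyp_isom_group\<^esub> h) = rep g \<otimes>\<^bsub>hyp_isom_group\<^esub> rep h"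
    if g: "g \<in> hyp_isom" and h: "h \<in> hyp_isom" for g h
  proof -
    have "compose hyp g h \<in> hyp_isom"
      using G.m_closed[of g h] g h by (simp add: carrier_hyp_isom_group mult_hyp_isom_group)
    then have "rep (compose hyp g h) = compose hyp (rep g) (rep h)"
      using lift_compose[OF g h] lorentz_plusD(5)[OF lift_plus[OF h]]
      by (auto simp: rep_def compose_def fun_eq_iff)
    then show ?thesis
      using g h by (simp add: mult_hyp_isom_group rep_isom)
  qed
  then show ?thesis
    by (simp add: hom_def carrier_hyp_isom_group rep_isom Pi_def)
qed

lemma rep_equivariant: "g \<in> hyp_isom \<Longrightarrow> x \<in> hyp \<Longrightarrow> rep g (f x) = f (g x)"
  by (simp add: rep_def f_hyp lift_f)

end

section \<open>The power map is an embedding\<close>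

text \<open>Stated for an arbitrary positive exponent, so that it applies to \<open>f\<close> and, with exponent
  \<open>1 / t\<close>, to its inverse.\<close>

lemma continuous_on_lorentz_powr:
  assumes A: "A \<subseteq> hyp" and f: "\<And>x. x \<in> A \<Longrightarrow> f x \<in> hyp" and "t > 0"
    and B: "\<And>x y. x \<in> A \<Longrightarrow> y \<in> A \<Longrightarrow> lorentz_form (f x) (f y) = lorentz_form x y powr t"
  shows "continuous_on A f"
  unfolding continuous_on_def
proof
  fix x assume x: "x \<in> A"
  have inA: "\<forall>\<^sub>F y in at x within A. y \<in> A"
    by (simp add: eventually_at_filter)
  have "((\<lambda>y. lorentz_form y x) \<longlongrightarrow> lorentz_form x x) (at x within A)"
    by (intro tendsto_intros)
  then have "((\<lambda>y. lorentz_form y x powr t) \<longlongrightarrow> 1 powr t) (at x within A)"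
    using x A by (intro tendsto_powr tendsto_const) (auto simp: lorentz_self)
  then have "((\<lambda>y. lorentz_form (f y) (f x)) \<longlongrightarrow> 1 powr t) (at x within A)"
    by (rule Lim_transform_eventually) (rule eventually_mono[OF inA], simp add: B x)
  then show "(f \<longlongrightarrow> f x) (at x within A)"
    using hyp_tendsto_iff[OF f[OF x] eventually_mono[OF inA f]] by simp
qed

context lorentz_power_map
begin

lemma embedding_f: "embedding_map hyp_topology hyp_topology f"
proof -
  have inj: "inj_on f hyp"
  proof (rule inj_onI)
    fix x y assume xy: "x \<in> hyp" "y \<in> hyp" "f x = f y"
    then have "lorentz_form x y powr t = 1"
      using lorentz_f[of x y] by (simp add: lorentz_self f_hyp)
    then have "(lorentz_form x y powr t) powr (1 / t) = 1"
      by simp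
    then have "lorentz_form x y = 1"
      using t_pos lorentz_hyp_ge_1[OF xy(1,2)] by (simp add: powr_powr)
    then show "x = y"
      using lorentz_eq_1_iff xy by blast
  qed
  define h where "h = inv_into hyp f"
  have h: "h (f x) = x" if "x \<in> hyp" for x
    using inj that by (simp add: h_def)
  have "continuous_on hyp f"
    by (rule continuous_on_lorentz_powr[OF _ f_hyp t_pos lorentz_f]) auto
  moreover have "continuous_on (f ` hyp) h"
  proof (rule continuous_on_lorentz_powr[of _ _ "1 / t"])
    fix u v assume "u \<in> f ` hyp" "v \<in> f ` hyp"
    then obtain x y where xy: "x \<in> hyp" "y \<in> hyp" "u = f x" "v = f y"
      by blast
    have "(lorentz_form x y powr t) powr (1 / t) = lorentz_form x y"
      using t_pos lorentz_hyp_ge_1[OF xy(1,2)] by (simp add: powr_powr)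
    then show "lorentz_form (h u) (h v) = lorentz_form u v powr (1 / t)"
      using xy by (simp add: h lorentz_f)
  qed (use t_pos f_hyp h in auto)
  ultimately have "homeomorphic_maps (top_of_set hyp) (top_of_set (f ` hyp)) f h"
    using h by (auto simp: homeomorphic_maps_def)
  then have "homeomorphic_map (top_of_set hyp) (top_of_set (f ` hyp)) f"
    by (rule homeomorphic_maps_imp_map)
  moreover have "hyp \<inter> f ` hyp = f ` hyp"
    using f_hyp by blast
  ultimately show ?thesis
    by (simp add: embedding_map_def hyp_topology_eq subtopology_subtopology)
qed

end

section \<open>Continuity of the representation\<close>

lemma lorentz_le_norm: "\<bar>lorentz_form u w\<bar> \<le> norm u * norm w"
proof -
  have "lorentz_form u w = u \<bullet> (fst w, - snd w)"
    by (simp add: lorentz_form_def inner_prod_def)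
  moreover have "norm (fst w, - snd w) = norm w"
    by (simp add: norm_prod_def)
  ultimately show ?thesis
    using Cauchy_Schwarz_ineq2[of u "(fst w, - snd w)"] by simp
qed

lemma hyp_norm_le:
  assumes "w \<in> hyp"
  shows "norm w \<le> 2 * fst w"
proof (rule power2_le_imp_le)
  have "(norm w)\<^sup>2 = 2 * (fst w)\<^sup>2 - 1" and "(2 * fst w)\<^sup>2 = 4 * (fst w)\<^sup>2"
    using assms by (simp_all add: norm_sq_lorentz lorentz_self power_mult_distrib)
  then show "(norm w)\<^sup>2 \<le> (2 * fst w)\<^sup>2"
    using zero_le_power2[of "fst w"] by linarith
qed (use hyp_fst_pos[OF assms] in simp)

lemma topspace_hyp_isom: "topspace hyp_isom_topology = hyp_isom"
proof -
  have "hyp_isom \<subseteq> (hyp \<rightarrow>\<^sub>E (hyp :: (real \<times> 'a) set))"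
    by (rule subsetI) (simp add: PiE_iff hyp_isom_mem hyp_isom_def Bij_def)
  then show ?thesis
    by (auto simp: hyp_isom_topology_def hyp_topology_eq)
qed

context lorentz_power_map
begin

lemma tendsto_eval:
  assumes g0: "g0 \<in> hyp_isom" and x: "x \<in> hyp"
  shows "((\<lambda>g. g x) \<longlongrightarrow> g0 x) (atin hyp_isom_topology g0)"
proof -
  have "continuous_map hyp_isom_topology (top_of_set hyp) (\<lambda>g. g x)"
    unfolding hyp_isom_topology_def hyp_topology_eq
    by (intro continuous_map_from_subtopology continuous_map_product_projection x)
  moreover have "g0 \<in> topspace hyp_isom_topology"
    by (simp add: topspace_hyp_isom g0)
  ultimately show ?thesis
    unfolding continuous_map_atin by (simp add: limitin_subtopology)
qed

lemma eventually_hyp_isom: "\<forall>\<^sub>F g in atin hyp_isom_topology g0. g \<in> (hyp_isom :: (real \<times> 'h \<Rightarrow> real \<times> 'h) set)"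
proof -
  have "openin hyp_isom_topology (hyp_isom :: (real \<times> 'h \<Rightarrow> real \<times> 'h) set)"
    using openin_topspace[of "hyp_isom_topology :: (real \<times> 'h \<Rightarrow> real \<times> 'h) topology"]
    by (simp only: topspace_hyp_isom)
  then show ?thesis
    by (auto simp: eventually_atin topspace_hyp_isom)
qed

lemma tendsto_lift_f:
  assumes g0: "g0 \<in> hyp_isom" and x: "x \<in> hyp"
  shows "((\<lambda>g. lift g (f x)) \<longlongrightarrow> lift g0 (f x)) (atin hyp_isom_topology g0)"
proof -
  have cont: "continuous_on hyp f"
    by (rule continuous_on_lorentz_powr[OF _ f_hyp t_pos lorentz_f]) auto
  have "((\<lambda>g. f (g x)) \<longlongrightarrow> f (g0 x)) (atin hyp_isom_topology g0)"
    by (rule continuous_on_tendsto_compose[OF cont tendsto_eval[OF g0 x]])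
       (use g0 x in \<open>auto intro: eventually_mono[OF eventually_hyp_isom] simp: hyp_isom_mem\<close>)
  then show ?thesis
    unfolding lift_f[OF g0 x]
    by (rule Lim_transform_eventually)
       (rule eventually_mono[OF eventually_hyp_isom], simp add: lift_f x)
qed

text \<open>For \<open>v\<close> in the image of \<open>f\<close> this is continuity of \<open>f\<close>. The set of all \<open>v\<close> for which it holds is
  a subspace, and it is closed since the linear functionals \<open>u \<mapsto> lorentz_form (lift g u) z\<close> are
  bounded uniformly for \<open>g\<close> near \<open>g0\<close>: such a functional is the product with the point
  \<open>w \<in> hyp\<close> satisfying \<open>lift g w = z\<close>, and the norm of \<open>w\<close> is at most twice its first coordinate
  \<open>lorentz_form z (lift g (1, 0))\<close>.\<close>

lemma tendsto_lorentz_lift: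
  assumes g0: "g0 \<in> hyp_isom" and z: "z \<in> hyp"
  shows "((\<lambda>g. lorentz_form (lift g v) z) \<longlongrightarrow> lorentz_form (lift g0 v) z) (atin hyp_isom_topology g0)"
proof -
  let ?F = "atin hyp_isom_topology g0"
  have bound: "\<bar>lorentz_form (lift g u) z\<bar> \<le> norm u * (2 * lorentz_form z (lift g (1, 0)))"
    if g: "g \<in> hyp_isom" for g u
  proof -
    have T: "lift g \<in> lorentz_plus"
      by (rule lift_plus[OF g])
    have "z \<in> lift g ` hyp"
      unfolding lorentz_plusD(4)[OF T] by (rule z)
    then obtain w where w: "w \<in> hyp" "lift g w = z"
      by (metis imageE)
    have "\<bar>lorentz_form (lift g u) z\<bar> = \<bar>lorentz_form u w\<bar>"
      by (simp add: lorentz_plusD(3)[OF T] flip: w(2))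
    also have "\<dots> \<le> norm u * norm w"
      by (rule lorentz_le_norm)
    also have "\<dots> \<le> norm u * (2 * fst w)"
      by (intro mult_left_mono hyp_norm_le w) simp
    also have "fst w = lorentz_form z (lift g (1, 0))"
      by (simp add: lorentz_plusD(3)[OF T] lorentz_origin flip: w(2))
    finally show ?thesis .
  qed
  define L where "L = lorentz_form z (lift g0 (1, 0))"
  have "((\<lambda>g. lorentz_form z (lift g (1, 0))) \<longlongrightarrow> L) ?F"
    unfolding L_def using tendsto_lift_f[OF g0 origin_in_hyp] by (intro tendsto_intros) (simp add: f_origin)
  then have ev: "\<forall>\<^sub>F g in ?F. lorentz_form z (lift g (1, 0)) < L + 1"
    by (rule order_tendstoD) simp
  have L: "L \<ge> 1"
    unfolding L_def by (rule lorentz_hyp_ge_1[OF z lorentz_plusD(5)[OF lift_plus[OF g0] origin_in_hyp]])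
  define V where "V = {v. ((\<lambda>g. lorentz_form (lift g v) z) \<longlongrightarrow> lorentz_form (lift g0 v) z) ?F}"
  have lin: "linear (lift g)" if "g \<in> hyp_isom" for g
    using lift_plus[OF that] by (rule lorentz_plusD)
  have "span (f ` hyp) \<subseteq> V"
  proof (rule span_minimal)
    show "f ` hyp \<subseteq> V"
      unfolding V_def by (auto intro!: tendsto_lorentz tendsto_const tendsto_lift_f[OF g0])
    show "subspace V"
      unfolding subspace_def
    proof (intro conjI ballI allI)
      show "0 \<in> V"
        unfolding V_def mem_Collect_eq
        by (rule Lim_transform_eventually[OF tendsto_const])
           (rule eventually_mono[OF eventually_hyp_isom], simp add: linear_0[OF lin] g0)
    next
      fix v w assume "v \<in> V" "w \<in> V"
      then have "((\<lambda>g. lorentz_form (lift g v) z + lorentz_form (lift g w) z)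
          \<longlongrightarrow> lorentz_form (lift g0 v) z + lorentz_form (lift g0 w) z) ?F"
        unfolding V_def by (intro tendsto_add) simp_all
      moreover have "lorentz_form (lift g (v + w)) z = lorentz_form (lift g v) z + lorentz_form (lift g w) z"
        if "g \<in> hyp_isom" for g
        using that by (simp add: linear_add[OF lin] lorentz_add_left)
      ultimately show "v + w \<in> V"
        unfolding V_def mem_Collect_eq using g0
        by (auto elim!: Lim_transform_eventually intro: eventually_mono[OF eventually_hyp_isom])
    next
      fix c v assume "v \<in> V"
      then have "((\<lambda>g. c * lorentz_form (lift g v) z) \<longlongrightarrow> c * lorentz_form (lift g0 v) z) ?F"
        unfolding V_def by (intro tendsto_mult_left) simp_all
      moreover have "lorentz_form (lift g (c *\<^sub>R v)) z = c * lorentz_form (lift g v) z"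
        if "g \<in> hyp_isom" for g
        using that by (simp add: linear_scale[OF lin] lorentz_scale_left)
      ultimately show "c *\<^sub>R v \<in> V"
        unfolding V_def using g0 by (auto elim!: Lim_transform_eventually intro: eventually_mono[OF eventually_hyp_isom])
    qed
  qed
  moreover have "v \<in> closure (span (f ` hyp))"
    by (simp add: dense_span_f)
  ultimately have v: "v \<in> closure V"
    using closure_mono by blast
  show ?thesis
  proof (rule tendstoI)
    fix \<epsilon> :: real assume "\<epsilon> > 0"
    define \<delta> where "\<delta> = \<epsilon> / (6 * (L + 1))"
    have \<delta>: "\<delta> > 0" "\<delta> * (2 * (L + 1)) = \<epsilon> / 3"
      using L \<open>\<epsilon> > 0\<close> by (simp_all add: \<delta>_def field_simps)
    obtain u where u: "u \<in> V" "dist u v < \<delta>"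
      using v \<delta>(1) by (meson closure_approachable)
    have close: "\<bar>lorentz_form (lift g v) z - lorentz_form (lift g u) z\<bar> \<le> \<epsilon> / 3"
      if g: "g \<in> hyp_isom" and "lorentz_form z (lift g (1, 0)) < L + 1" for g
    proof -
      have "lorentz_form (lift g v) z - lorentz_form (lift g u) z = lorentz_form (lift g (v - u)) z"
        by (simp add: linear_diff[OF lin[OF g]] lorentz_diff_left)
      also have "\<bar>\<dots>\<bar> \<le> norm (v - u) * (2 * lorentz_form z (lift g (1, 0)))"
        by (rule bound[OF g])
      also have "\<dots> \<le> \<delta> * (2 * (L + 1))"
        using u(2) that(2) \<delta>(1) lorentz_hyp_ge_1[OF z lorentz_plusD(5)[OF lift_plus[OF g] origin_in_hyp]]
        by (intro mult_mono) (simp_all add: dist_norm norm_minus_commute)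
      finally show ?thesis
        using \<delta>(2) by simp
    qed
    have "\<forall>\<^sub>F g in ?F. dist (lorentz_form (lift g u) z) (lorentz_form (lift g0 u) z) < \<epsilon> / 3"
      using u(1) \<open>\<epsilon> > 0\<close> unfolding V_def by (intro tendstoD) auto
    then show "\<forall>\<^sub>F g in ?F. dist (lorentz_form (lift g v) z) (lorentz_form (lift g0 v) z) < \<epsilon>"
      using ev eventually_hyp_isom
    proof eventually_elim
      case (elim g)
      have "\<bar>lorentz_form (lift g0 v) z - lorentz_form (lift g0 u) z\<bar> \<le> \<epsilon> / 3"
        by (rule close[OF g0]) (simp add: L_def)
      then show ?case
        using elim(1) close[OF elim(3,2)] unfolding dist_real_def by linarith
    qed
  qed
qed

lemma continuous_rep: "continuous_map hyp_isom_topology hyp_isom_topology rep"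
proof -
  have "continuous_map hyp_isom_topology (top_of_set hyp) (\<lambda>g. rep g y)" if y: "y \<in> hyp" for y
    unfolding continuous_map_atin
  proof
    fix g0 :: "real \<times> 'h \<Rightarrow> real \<times> 'h"
    assume "g0 \<in> topspace hyp_isom_topology"
    then have g0: "g0 \<in> hyp_isom"
      by (simp add: topspace_hyp_isom)
    have mem: "lift g y \<in> hyp" if "g \<in> hyp_isom" for g
      using lorentz_plusD(5)[OF lift_plus[OF that] y] .
    have "((\<lambda>g. lorentz_form (lift g y) (lift g0 y)) \<longlongrightarrow> 1) (atin hyp_isom_topology g0)"
      using tendsto_lorentz_lift[OF g0 mem[OF g0], of y] by (simp add: lorentz_self mem[OF g0])
    then have "((\<lambda>g. lift g y) \<longlongrightarrow> lift g0 y) (atin hyp_isom_topology g0)"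
      by (subst hyp_tendsto_iff[OF mem[OF g0] eventually_mono[OF eventually_hyp_isom mem]])
    then show "limitin (top_of_set hyp) (\<lambda>g. rep g y) (rep g0 y) (atin hyp_isom_topology g0)"
      using y mem[OF g0] eventually_mono[OF eventually_hyp_isom mem]
      by (simp add: rep_def limitin_subtopology)
  qed
  then have "continuous_map hyp_isom_topology (product_topology (\<lambda>_. hyp_topology) hyp) rep"
    by (auto simp: continuous_map_componentwise hyp_topology_eq rep_def)
  then have "continuous_map hyp_isom_topology (subtopology (product_topology (\<lambda>_. hyp_topology) hyp) hyp_isom) rep"
    by (auto simp: continuous_map_in_subtopology topspace_hyp_isom rep_isom)
  then show ?thesis
    by (simp only: hyp_isom_topology_def)
qed

end

section \<open>Irreducibility\<close>

text \<open>A form of Bessel's inequality: a vector cannot have the same nonzero product with infinitely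
  many orthogonal vectors of equal length.\<close>

lemma equal_inner_orthogonal_sequence:
  fixes w :: "nat \<Rightarrow> 'a::real_inner"
  assumes w: "\<And>i j. w i \<bullet> w j = (if i = j then d else 0)" and c: "\<And>i. p \<bullet> w i = c"
  shows "c = 0"
proof (rule ccontr)
  assume "c \<noteq> 0"
  have bound: "real n * c\<^sup>2 \<le> (norm p)\<^sup>2 * d" for n
  proof (cases "n = 0")
    case True
    have "d \<ge> 0"
      using w[of 0 0] inner_ge_zero[of "w 0"] by simp
    then show ?thesis
      using True by simp
  next
    case False
    define S where "S = (\<Sum>i<n. w i)"
    have "p \<bullet> S = real n * c"
      by (simp add: S_def inner_sum_right c)
    moreover have "S \<bullet> S = real n * d"
      by (simp add: S_def inner_sum_right inner_sum_left w)
    ultimately have "(real n * c)\<^sup>2 \<le> (norm p)\<^sup>2 * (real n * d)"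
      using Cauchy_Schwarz_ineq[of p S] by (simp add: power2_norm_eq_inner)
    then have "real n * (real n * c\<^sup>2) \<le> real n * ((norm p)\<^sup>2 * d)"
      by (simp add: power2_eq_square algebra_simps)
    then show ?thesis
      using False by simp
  qed
  obtain n :: nat where "(norm p)\<^sup>2 * d < real n * c\<^sup>2"
    using reals_Archimedean3[of "c\<^sup>2"] \<open>c \<noteq> 0\<close> by auto
  then show False
    using bound[of n] by linarith
qed

context lorentz_power_map
begin

text \<open>The stabilizer of \<open>(1, 0)\<close> acts by isometries for the inner product.\<close>

lemma lift_fixes_origin:
  assumes "g \<in> hyp_isom" "g (1, 0) = (1, 0)"
  shows "fst (lift g v) = fst v" "lift g v \<bullet> lift g w = v \<bullet> w"
proof -
  have *: "fst (lift g v) = fst v" for v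
    using lorentz_plusD(3)[OF lift_plus[OF assms(1)], of v "(1, 0)"] lift_f[OF assms(1) origin_in_hyp]
    by (simp add: f_origin assms(2) lorentz_origin)
  show "fst (lift g v) = fst v"
    by (rule *)
  show "lift g v \<bullet> lift g w = v \<bullet> w"
    by (simp add: inner_eq_lorentz * lorentz_plusD(3)[OF lift_plus[OF assms(1)]])
qed

lemma isom_swap:
  assumes "x \<in> hyp" "y \<in> hyp"
  obtains g where "g \<in> hyp_isom" "g x = y" "fst x = fst y \<Longrightarrow> g (1, 0) = (1, 0)"
proof (rule that)
  let ?R = "lorentz_reflection (x - y)"
  show "restrict ?R hyp \<in> hyp_isom"
    by (intro restrict_lorentz_plus lorentz_reflection_plus assms)
  show "restrict ?R hyp x = y"
    using assms by (simp add: lorentz_reflection_swaps)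
  show "restrict ?R hyp (1, 0) = (1, 0)" if "fst x = fst y"
    using that by (simp add: origin_in_hyp lorentz_reflection_def lorentz_diff_right lorentz_origin)
qed

text \<open>By invariance, \<open>p\<close> has the same product with \<open>f y\<close> for all \<open>y\<close> with a given first coordinate.
  Taking the points \<open>y i\<close> in the directions of an orthonormal sequence, the vectors \<open>snd (f (y i))\<close>
  are orthogonal of equal length, so this product has no contribution from \<open>snd p\<close>. This is the
  step of the irreducibility proof that needs infinite dimension.\<close>

lemma stabilizer_fixed_vector:
  assumes e: "\<And>i j :: nat. (e i :: 'h) \<bullet> e j = (if i = j then 1 else 0)"
    and fixed: "\<And>g. g \<in> hyp_isom \<Longrightarrow> g (1, 0) = (1, 0) \<Longrightarrow> lift g p = p"
  shows "snd p = 0"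
proof -
  have *: "snd p \<bullet> snd (f x) = 0" if x: "x \<in> hyp" for x
  proof -
    define y where "y i = (fst x, norm (snd x) *\<^sub>R e i)" for i :: nat
    have y: "y i \<in> hyp" for i
      using hyp_fst_sq[OF x] hyp_fst_pos[OF x]
      by (simp add: y_def hyp_def lorentz_form_def e power2_eq_square)
    have "snd p \<bullet> snd (f (y i)) = snd p \<bullet> snd (f x)" for i
    proof -
      obtain g where g: "g \<in> hyp_isom" "g x = y i" "g (1, 0) = (1, 0)"
        using isom_swap[OF x y[of i]] by (auto simp: y_def)
      have "p \<bullet> f (y i) = lift g p \<bullet> lift g (f x)"
        using g x by (simp add: fixed lift_f)
      also have "\<dots> = p \<bullet> f x"
        by (rule lift_fixes_origin(2)[OF g(1,3)])
      finally show ?thesis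
        using fst_f[OF x] fst_f[OF y[of i]] by (simp add: inner_prod_def y_def)
    qed
    moreover have "snd (f (y i)) \<bullet> snd (f (y j)) = (if i = j then (fst x powr t)\<^sup>2 - 1 else 0)" for i j
    proof -
      have "lorentz_form (y i) (y j) = (if i = j then 1 else (fst x)\<^sup>2)"
        using lorentz_self[OF y[of i]] by (simp add: y_def lorentz_form_def e power2_eq_square)
      then have "lorentz_form (f (y i)) (f (y j)) = (if i = j then 1 else (fst x powr t)\<^sup>2)"
        using lorentz_f[OF y y, of i j] hyp_fst_pos[OF x] by (simp add: power2_eq_square powr_mult)
      moreover have "fst (f (y i)) = fst x powr t" for i
        using fst_f[OF y] by (simp add: y_def)
      ultimately show ?thesis
        unfolding lorentz_form_def by (simp add: power2_eq_square split: if_splits)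
    qed
    ultimately show ?thesis
      by (intro equal_inner_orthogonal_sequence[of "\<lambda>i. snd (f (y i))" _ "snd p"]) auto
  qed
  have "(0, - snd p) = (0 :: real \<times> 'h)"
    by (rule total_f) (simp add: lorentz_form_def *)
  then show ?thesis
    by (simp add: zero_prod_def)
qed

text \<open>For an invariant closed subspace \<open>V\<close>, the projection \<open>p\<close> of \<open>(1, 0)\<close> to \<open>V\<close> is fixed by the
  stabilizer of \<open>(1, 0)\<close>, hence a multiple of \<open>(1, 0)\<close>. If it is not \<open>0\<close>, then \<open>V\<close> contains
  \<open>(1, 0)\<close> and, by transitivity, the image of \<open>f\<close>; otherwise \<open>V\<close> is orthogonal to \<open>(1, 0)\<close>
  and, again by transitivity, to the image of \<open>f\<close>.\<close>

lemma irreducible_rep_rep: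
  assumes e: "\<And>i j :: nat. (e i :: 'h) \<bullet> e j = (if i = j then 1 else 0)"
  shows "irreducible_rep hyp_isom_group rep"
  unfolding irreducible_rep_def
proof (intro allI impI, elim conjE)
  fix V :: "(real \<times> 'h) set"
  assume V: "subspace V" "closed V" and inv: "\<forall>g\<in>carrier hyp_isom_group. linear_extension (rep g) ` V \<subseteq> V"
  have inv: "lift g v \<in> V" if "g \<in> hyp_isom" "v \<in> V" for g v
    using inv that by (auto simp: carrier_hyp_isom_group linear_extension_rep)
  obtain p where p: "p \<in> V" "\<And>v. v \<in> V \<Longrightarrow> ((1, 0) - p) \<bullet> v = 0"
    using orthogonal_projection_exists[OF V] by blast
  have "lift g p = p" if g: "g \<in> hyp_isom" "g (1, 0) = (1, 0)" for g
  proof -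
    have o_inner: "(1, 0) \<bullet> v = fst v" for v :: "real \<times> 'h"
      by (simp add: inner_prod_def)
    have pp: "p \<bullet> v = (1, 0) \<bullet> v" if "v \<in> V" for v
      using p(2)[OF that] by (simp add: inner_diff_left)
    have "lift g p \<in> V"
      by (rule inv[OF g(1) p(1)])
    then have "p \<bullet> lift g p = p \<bullet> p"
      using pp[OF p(1)] pp[of "lift g p"] lift_fixes_origin(1)[OF g, of p] by (simp add: o_inner)
    then have "(lift g p - p) \<bullet> (lift g p - p) = 0"
      using lift_fixes_origin(2)[OF g, of p p] by (simp add: algebra_simps inner_commute)
    then show ?thesis
      by simp
  qed
  then have "snd p = 0"
    using stabilizer_fixed_vector[OF e] by blast
  then have p_eq: "p = fst p *\<^sub>R (1, 0)"
    by (simp add: prod_eq_iff)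
  show "V = {0} \<or> V = UNIV"
  proof (cases "fst p = 0")
    case True
    then have "p = 0"
      using p_eq by (metis scaleR_zero_left)
    then have fst0: "fst v = 0" if "v \<in> V" for v
      using p(2)[OF that] by (simp add: inner_prod_def)
    have "v = 0" if v: "v \<in> V" for v
    proof (rule total_f)
      fix x :: "real \<times> 'h" assume x: "x \<in> hyp"
      obtain g where g: "g \<in> hyp_isom" "g x = (1, 0)"
        using isom_swap[OF x origin_in_hyp] by blast
      have "lorentz_form v (f x) = lorentz_form (lift g v) (lift g (f x))"
        by (simp add: lorentz_plusD(3)[OF lift_plus[OF g(1)]])
      also have "\<dots> = fst (lift g v)"
        by (simp add: lift_f[OF g(1) x] g(2) f_origin lorentz_origin)
      finally show "lorentz_form v (f x) = 0"
        using fst0[OF inv[OF g(1) v]] by simp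
    qed
    then show ?thesis
      using subspace_0[OF V(1)] by blast
  next
    case False
    have "(1 / fst p) *\<^sub>R p \<in> V"
      by (rule subspace_scale[OF V(1) p(1)])
    also have "(1 / fst p) *\<^sub>R p = (1, 0)"
      using False by (subst (2) p_eq) simp
    finally have o: "(1, 0) \<in> V" .
    have "f x \<in> V" if x: "x \<in> hyp" for x
    proof -
      obtain g where g: "g \<in> hyp_isom" "g (1, 0) = x"
        using isom_swap[OF origin_in_hyp x] by blast
      show ?thesis
        using inv[OF g(1) o] lift_f[OF g(1) origin_in_hyp] by (simp add: f_origin g(2))
    qed
    then have "closure (span (f ` hyp)) \<subseteq> V"
      by (intro closure_minimal span_minimal V) blast
    then show ?thesis
      by (auto simp: dense_span_f)
  qed
qed

end

theorem mainTheorem2: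
  fixes t :: real
  assumes "separable_space (euclidean :: 'h::{real_inner, complete_space} topology)"
    and "\<nexists>S :: 'h set. finite S \<and> span S = UNIV"
    and "0 < t" and "t \<le> 1"
  shows "\<exists>(\<rho> :: (real \<times> 'h \<Rightarrow> real \<times> 'h) \<Rightarrow> (real \<times> 'h \<Rightarrow> real \<times> 'h))
           (f :: real \<times> 'h \<Rightarrow> real \<times> 'h).
      \<rho> \<in> hom hyp_isom_group hyp_isom_group \<and>
      continuous_map hyp_isom_topology hyp_isom_topology \<rho> \<and>
      irreducible_rep (hyp_isom_group :: (real \<times> 'h \<Rightarrow> real \<times> 'h) monoid) \<rho> \<and>
      embedding_map hyp_topology hyp_topology f \<and>
      (\<forall>g\<in>hyp_isom. \<forall>x\<in>hyp. f (g x) = \<rho> g (f x)) \<and>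
      (\<forall>x\<in>hyp. \<forall>y\<in>hyp. cosh (hyp_dist (f x) (f y)) = cosh (hyp_dist x y) powr t)"
proof -
  have "\<nexists>S. finite S \<and> (UNIV :: 'h set) \<subseteq> span S"
    using assms(2) by (metis top.extremum_uniqueI)
  then obtain e :: "nat \<Rightarrow> 'h" where e: "\<And>i j. e i \<bullet> e j = (if i = j then 1 else 0)"
    using orthonormal_sequence_exists[OF assms(1) _ subspace_UNIV] by metis
  obtain f :: "real \<times> 'h \<Rightarrow> real \<times> 'h" where f:
    "\<And>x y. x \<in> hyp \<Longrightarrow> y \<in> hyp \<Longrightarrow> lorentz_form (f x) (f y) = lorentz_form x y powr t"
    "\<And>x. x \<in> hyp \<Longrightarrow> fst (f x) = fst x powr t"
    "\<And>u. (\<And>x. x \<in> hyp \<Longrightarrow> lorentz_form u (f x) = 0) \<Longrightarrow> u = 0"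
    using lorentz_power_map_exists[OF assms] by blast
  interpret lorentz_power_map f t
    by unfold_locales (fact assms(3) f)+
  show ?thesis
  proof (intro exI[of _ rep] exI[of _ f] conjI ballI)
    show "cosh (hyp_dist (f x) (f y)) = cosh (hyp_dist x y) powr t" if "x \<in> hyp" "y \<in> hyp" for x y
      using that by (simp add: cosh_hyp_dist f_hyp lorentz_f)
  qed (simp_all add: rep_hom continuous_rep irreducible_rep_rep[OF e] embedding_f rep_equivariant)
qed

end
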